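(* Let $\alpha=(\alpha_n)_{n\in\mathbb N}$ be a positive, strictly increasing sequence with $\alpha_n\to\infty$ such that $E_\alpha$ is nuclear. Then the Cesàro operator $\mathsf C\in\mathcal L(E_\alpha)$ satisfies: (i) $\sigma(\mathsf C;E_\alpha)=\sigma_{pt}(\mathsf C;E_\alpha)=\Sigma$, and (ii) $\sigma^*(\mathsf C;E_\alpha)=\sigma(\mathsf C;E_\alpha)\cup\{0\}=\Sigma_0$, where $\Sigma=\{\frac1n:n\in\mathbb N\}$ and $\Sigma_0=\{0\}\cup\Sigma$.
   Context: $\mathbb N=\{1,2,3,\dots\}$. For a strictly positive sequence $w$ on $\mathbb N$, $c_0(w)=\{x\in\mathbb C^{\mathbb N}: \lim_{n\to\infty} w(n)|x_n|=0\}$, a Banach space with norm $\sup_n w(n)|x_n|$. Given $\alpha$, fix a strictly increasing sequence $(s_k)_{k\in\mathbb N}\subset(1,\infty)$ with $s_k\to\infty$ and put $v_k(n):=s_k^{-\alpha_n}$. Define $E_\alpha:=\mathrm{ind}_k\, c_0(v_k)$, i.e. $E_\alpha=\bigcup_k c_0(v_k)\subseteq\mathbb C^{\mathbb N}$ endowed with the finest locally convex Hausdorff topology making all inclusions $c_0(v_k)\hookrightarrow E_\alpha$ continuous; $E_\alpha$ does not depend on the choice of $(s_k)$. It is known that $E_\alpha$ is nuclear if and only if $\sup_n\frac{\log n}{\alpha_n}<\infty$. The Cesàro operator is $\mathsf Cx=\left(\frac{x_1+\dots+x_n}{n}\right)_{n\in\mathbb N}$, and it belongs to $\mathcal L(E_\alpha)$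 (continuous linear operators from $E_\alpha$ into itself). For a locally convex Hausdorff space $X$ and $T\in\mathcal L(X)$: $\rho(T;X)$ is the set of $\lambda\in\mathbb C$ such that $R(\lambda,T):=(\lambda I-T)^{-1}$ exists in $\mathcal L(X)$; $\sigma(T;X)=\mathbb C\setminus\rho(T;X)$; $\sigma_{pt}(T;X)$ is the set of $\lambda$ for which $\lambda I-T$ is not injective; $\rho^*(T;X)$ is the set of $\lambda\in\mathbb C$ for which there is $\delta>0$ such that the open disc $B(\lambda,\delta)\subseteq\rho(T;X)$ and $\{R(\mu,T):\mu\in B(\lambda,\delta)\}$ is equicontinuous in $\mathcal L(X)$; $\sigma^*(T;X)=\mathbb C\setminus\rho^*(T;X)$. *)

theory Defs
  imports "HOL-Analysis.Analysis" "HOL-Library.Function_Algebras"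
begin

text \<open>
  A complex sequence \<open>(x\<^sub>n)\<close> with \<open>n = 1, 2, 3, \<dots>\<close> is a function on \<^typ>\<open>nat\<close> whose value at \<open>n\<close>
  is the entry with number \<open>Suc n\<close>; all other sequences (weights, exponents) are shifted in the same
  way. A locally convex space of sequences is a topology whose \<^const>\<open>topspace\<close> is a linear subspace.
  Addition and subtraction of sequences are those of \<^theory>\<open>HOL-Library.Function_Algebras\<close>.
\<close>

type_synonym cseq = "nat \<Rightarrow> complex"

definition cscale :: "complex \<Rightarrow> cseq \<Rightarrow> cseq"  (infixr "*\<^sub>C" 75)
  where "c *\<^sub>C x = (\<lambda>n. c * x n)"

interpretation cseq: vector_space cscale
  by unfold_locales (auto simp: cscale_def fun_eq_iff algebra_simps)

definition cseq_convex :: "cseq set \<Rightarrow> bool" where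
  "cseq_convex U \<longleftrightarrow>
     (\<forall>x\<in>U. \<forall>y\<in>U. \<forall>t::real. 0 \<le> t \<and> t \<le> 1 \<longrightarrow>
        of_real (1 - t) *\<^sub>C x + of_real t *\<^sub>C y \<in> U)"

definition lc_Hausdorff :: "cseq topology \<Rightarrow> bool" where
  "lc_Hausdorff X \<longleftrightarrow>
     cseq.subspace (topspace X) \<and>
     continuous_map (prod_topology X X) X (\<lambda>(x, y). x + y) \<and>
     continuous_map (prod_topology euclidean X) X (\<lambda>(c, x). c *\<^sub>C x) \<and>
     Hausdorff_space X \<and>
     (\<forall>U. openin X U \<and> 0 \<in> U \<longrightarrow>
        (\<exists>V. openin X V \<and> 0 \<in> V \<and> V \<subseteq> U \<and> cseq_convex V))"


subsection \<open>Inductive limits\<close>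

definition ind_compatible :: "(nat \<Rightarrow> cseq topology) \<Rightarrow> cseq topology \<Rightarrow> bool" where
  "ind_compatible F X \<longleftrightarrow>
     lc_Hausdorff X \<and> topspace X = (\<Union>k. topspace (F k)) \<and>
     (\<forall>k. continuous_map (F k) X (\<lambda>x. x))"

definition is_ind_lim :: "(nat \<Rightarrow> cseq topology) \<Rightarrow> cseq topology \<Rightarrow> bool" where
  "is_ind_lim F X \<longleftrightarrow>
     ind_compatible F X \<and> (\<forall>Y. ind_compatible F Y \<longrightarrow> (\<forall>U. openin Y U \<longrightarrow> openin X U))"

text \<open>
  Such a finest topology is clearly unique, and it exists as soon as there is one compatible
  topology; see \<open>is_ind_lim_ind_lim\<close> below.
\<close>

definition ind_lim :: "(nat \<Rightarrow> cseq topology) \<Rightarrow> cseq topology" where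
  "ind_lim F = (THE X. is_ind_lim F X)"


subsection \<open>The spaces \<open>c\<^sub>0(w)\<close> and \<open>E\<^sub>\<alpha>\<close>\<close>

definition c0 :: "(nat \<Rightarrow> real) \<Rightarrow> cseq set" where
  "c0 w = {x. (\<lambda>n. w n * cmod (x n)) \<longlonglongrightarrow> 0}"

text \<open>
  The value 0 off \<open>c\<^sub>0(w)\<close> is irrelevant for the topology; it makes the distance non-negative
  everywhere, as \<^locale>\<open>Metric_space\<close> demands.
\<close>

definition c0_norm :: "(nat \<Rightarrow> real) \<Rightarrow> cseq \<Rightarrow> real" where
  "c0_norm w x = (if x \<in> c0 w then (SUP n. w n * cmod (x n)) else 0)"

definition c0_topology :: "(nat \<Rightarrow> real) \<Rightarrow> cseq topology" where
  "c0_topology w = Metric_space.mtopology (c0 w) (\<lambda>x y. c0_norm w (x - y))"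

definition E_weight :: "(nat \<Rightarrow> real) \<Rightarrow> (nat \<Rightarrow> real) \<Rightarrow> nat \<Rightarrow> nat \<Rightarrow> real" where
  "E_weight \<alpha> s k n = s k powr (- \<alpha> n)"

definition E_space :: "(nat \<Rightarrow> real) \<Rightarrow> (nat \<Rightarrow> real) \<Rightarrow> cseq topology" where
  "E_space \<alpha> s = ind_lim (\<lambda>k. c0_topology (E_weight \<alpha> s k))"


subsection \<open>Nuclearity\<close>

definition cont_seminorm :: "cseq topology \<Rightarrow> (cseq \<Rightarrow> real) \<Rightarrow> bool" where
  "cont_seminorm X p \<longleftrightarrow>
     (\<forall>x\<in>topspace X. 0 \<le> p x) \<and>
     (\<forall>x\<in>topspace X. \<forall>y\<in>topspace X. p (x + y) \<le> p x + p y) \<and>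
     (\<forall>c. \<forall>x\<in>topspace X. p (c *\<^sub>C x) = cmod c * p x) \<and>
     continuous_map X euclideanreal p"

text \<open>
  For seminorms \<open>p \<le> q\<close> let \<open>X\<^sub>p\<close>, \<open>X\<^sub>q\<close> be the normed quotients of \<open>X\<close> by the kernels of \<open>p\<close>, \<open>q\<close>.
  The canonical map \<open>X\<^sub>q \<rightarrow> X\<^sub>p\<close> is nuclear if it has the form \<open>x \<mapsto> (\<Sum>j. f\<^sub>j(x) y\<^sub>j)\<close> with \<open>f\<^sub>j\<close> in the
  dual of \<open>X\<^sub>q\<close>, \<open>y\<^sub>j\<close> in \<open>X\<^sub>p\<close> and \<open>(\<Sum>j. \<parallel>f\<^sub>j\<parallel> p(y\<^sub>j)) < \<infinity>\<close>. This is written out on representatives: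
  \<open>f\<^sub>j\<close> is a linear functional on \<open>X\<close> with \<open>\<bar>f\<^sub>j\<bar> \<le> C\<^sub>j q\<close> (so it factors through \<open>X\<^sub>q\<close> and has dual norm
  at most \<open>C\<^sub>j\<close>), and the series converges in the seminorm \<open>p\<close>. Passing to the completions of \<open>X\<^sub>p\<close>
  and \<open>X\<^sub>q\<close> gives the same notion, since a vector of the completion is the sum of an absolutely
  convergent series in \<open>X\<^sub>p\<close>, with sum of norms arbitrarily close to its norm.
\<close>

definition nuclear_canonical_map ::
    "cseq topology \<Rightarrow> (cseq \<Rightarrow> real) \<Rightarrow> (cseq \<Rightarrow> real) \<Rightarrow> bool" where
  "nuclear_canonical_map X q p \<longleftrightarrow>
     (\<exists>(f :: nat \<Rightarrow> cseq \<Rightarrow> complex) (C :: nat \<Rightarrow> real) (y :: nat \<Rightarrow> cseq).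
        (\<forall>j. \<forall>u\<in>topspace X. \<forall>v\<in>topspace X. f j (u + v) = f j u + f j v) \<and>
        (\<forall>j. \<forall>c. \<forall>u\<in>topspace X. f j (c *\<^sub>C u) = c * f j u) \<and>
        (\<forall>j. 0 \<le> C j \<and> (\<forall>u\<in>topspace X. cmod (f j u) \<le> C j * q u)) \<and>
        (\<forall>j. y j \<in> topspace X) \<and>
        summable (\<lambda>j. C j * p (y j)) \<and>
        (\<forall>u\<in>topspace X. (\<lambda>N. p (u - (\<Sum>j<N. f j u *\<^sub>C y j))) \<longlonglongrightarrow> 0))"

definition nuclear_space :: "cseq topology \<Rightarrow> bool" where
  "nuclear_space X \<longleftrightarrow>
     lc_Hausdorff X \<and>
     (\<forall>p. cont_seminorm X p \<longrightarrow>
        (\<exists>q. cont_seminorm X q \<and> (\<forall>x\<in>topspace X. p x \<le> q x) \<and> nuclear_canonical_map X q p))"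


subsection \<open>Operators and spectra\<close>

definition cont_linear_ops :: "cseq topology \<Rightarrow> (cseq \<Rightarrow> cseq) set" where
  "cont_linear_ops X =
     {T. (\<forall>x\<in>topspace X. \<forall>y\<in>topspace X. T (x + y) = T x + T y) \<and>
         (\<forall>c. \<forall>x\<in>topspace X. T (c *\<^sub>C x) = c *\<^sub>C T x) \<and>
         continuous_map X X T}"

definition equicontinuous :: "cseq topology \<Rightarrow> (cseq \<Rightarrow> cseq) set \<Rightarrow> bool" where
  "equicontinuous X H \<longleftrightarrow>
     H \<subseteq> cont_linear_ops X \<and>
     (\<forall>V. openin X V \<and> 0 \<in> V \<longrightarrow>
        (\<exists>U. openin X U \<and> 0 \<in> U \<and> (\<forall>S\<in>H. S ` U \<subseteq> V)))"

text \<open>\<open>\<lambda>I - T\<close>\<close>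

definition shift_op :: "(cseq \<Rightarrow> cseq) \<Rightarrow> complex \<Rightarrow> cseq \<Rightarrow> cseq" where
  "shift_op T l x = l *\<^sub>C x - T x"

definition resolvent :: "cseq topology \<Rightarrow> (cseq \<Rightarrow> cseq) \<Rightarrow> complex \<Rightarrow> cseq \<Rightarrow> cseq" where
  "resolvent X T l = inv_into (topspace X) (shift_op T l)"

definition resolvent_set :: "cseq topology \<Rightarrow> (cseq \<Rightarrow> cseq) \<Rightarrow> complex set" where
  "resolvent_set X T =
     {l. bij_betw (shift_op T l) (topspace X) (topspace X) \<and> resolvent X T l \<in> cont_linear_ops X}"

definition spectrum :: "cseq topology \<Rightarrow> (cseq \<Rightarrow> cseq) \<Rightarrow> complex set" where
  "spectrum X T = - resolvent_set X T"

definition point_spectrum :: "cseq topology \<Rightarrow> (cseq \<Rightarrow> cseq) \<Rightarrow> complex set" where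
  "point_spectrum X T = {l. \<not> inj_on (shift_op T l) (topspace X)}"

definition resolvent_set_star :: "cseq topology \<Rightarrow> (cseq \<Rightarrow> cseq) \<Rightarrow> complex set" where
  "resolvent_set_star X T =
     {l. \<exists>\<delta>>0. ball l \<delta> \<subseteq> resolvent_set X T \<and> equicontinuous X (resolvent X T ` ball l \<delta>)}"

definition spectrum_star :: "cseq topology \<Rightarrow> (cseq \<Rightarrow> cseq) \<Rightarrow> complex set" where
  "spectrum_star X T = - resolvent_set_star X T"

definition Cesaro :: "cseq \<Rightarrow> cseq" where
  "Cesaro x = (\<lambda>n. (\<Sum>i\<le>n. x i) / of_nat (Suc n))"

definition Sigma_set :: "complex set" where
  "Sigma_set = {1 / of_nat n | n. n \<ge> 1}"

definition Sigma0_set :: "complex set" where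
  "Sigma0_set = {0} \<union> Sigma_set"


subsection \<open>Well-definedness of \<open>E\<^sub>\<alpha>\<close>\<close>

lemma is_ind_lim_unique:
  assumes "is_ind_lim F X" "is_ind_lim F Y"
  shows "X = Y"
  using assms unfolding is_ind_lim_def topology_eq by blast

lemma ind_lim_eq: "is_ind_lim F X \<Longrightarrow> ind_lim F = X"
  unfolding ind_lim_def by (blast intro: is_ind_lim_unique)

lemma is_ind_lim_ind_lim:
  assumes Y0: "ind_compatible F Y0"
  shows "is_ind_lim F (ind_lim F)"
proof -
  define E where "E = (\<Union>k. topspace (F k))"
  define S where "S = {U. \<exists>Y. ind_compatible F Y \<and> openin Y U}"
  define T where "T = topology_generated_by S"
  have Tsp: "topspace Y = E" if "ind_compatible F Y" for Y
    using that by (simp add: ind_compatible_def E_def)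
  have US: "\<Union>S = E"
  proof
    show "\<Union>S \<subseteq> E" unfolding S_def using Tsp openin_subset by blast
    show "E \<subseteq> \<Union>S" unfolding S_def using Tsp[OF Y0] Y0 openin_topspace[of Y0] by auto
  qed
  have topT: "topspace T = E" by (simp add: T_def US)
  have finer: "openin T U" if "ind_compatible F Y" "openin Y U" for Y U
    using that unfolding T_def S_def by (blast intro: topology_generated_by_Basis)
  have idc: "continuous_map T Y (\<lambda>x. x)" if Y: "ind_compatible F Y" for Y
  proof -
    have "openin T {x \<in> topspace T. x \<in> U}" if "openin Y U" for U
    proof -
      have "{x \<in> topspace T. x \<in> U} = U"
        using openin_subset[OF that] Tsp[OF Y] topT by auto
      then show ?thesis using finer[OF Y that] by simp
    qed
    then show ?thesis
      unfolding continuous_map_def using Tsp[OF Y] topT by auto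
  qed
  have into: "continuous_map Z T g" if "\<And>Y. ind_compatible F Y \<Longrightarrow> continuous_map Z Y g" for Z :: "'c topology" and g
    unfolding T_def
  proof (rule continuous_on_generated_topo)
    fix U assume "U \<in> S"
    then obtain Y where Y: "ind_compatible F Y" "openin Y U" by (auto simp: S_def)
    have "openin Z {x \<in> topspace Z. g x \<in> U}"
      using that[OF Y(1)] Y(2) by (simp add: continuous_map_def)
    moreover have "{x \<in> topspace Z. g x \<in> U} = g -` U \<inter> topspace Z" by auto
    ultimately show "openin Z (g -` U \<inter> topspace Z)" by simp
  next
    show "g ` topspace Z \<subseteq> \<Union>S"
      using that[OF Y0] Tsp[OF Y0] US by (auto simp: continuous_map_def)
  qed
  have lc: "lc_Hausdorff Y" if "ind_compatible F Y" for Y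
    using that by (simp add: ind_compatible_def)
  have "lc_Hausdorff T"
    unfolding lc_Hausdorff_def
  proof (intro conjI allI impI)
    show "cseq.subspace (topspace T)"
      using lc[OF Y0] Tsp[OF Y0] topT by (simp add: lc_Hausdorff_def)
    show "continuous_map (prod_topology T T) T (\<lambda>(x, y). x + y)"
    proof (rule into)
      fix Y assume Y: "ind_compatible F Y"
      have 1: "continuous_map (prod_topology T T) (prod_topology Y Y) (\<lambda>z. (fst z, snd z))"
        by (intro continuous_map_pairedI
            continuous_map_compose[OF _ idc[OF Y], unfolded o_def] continuous_map_fst continuous_map_snd)
      have 2: "continuous_map (prod_topology Y Y) Y (\<lambda>(x, y). x + y)"
        using lc[OF Y] by (simp add: lc_Hausdorff_def)
      show "continuous_map (prod_topology T T) Y (\<lambda>(x, y). x + y)"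
        using continuous_map_compose[OF 1 2] by (simp add: o_def case_prod_beta')
    qed
    show "continuous_map (prod_topology euclidean T) T (\<lambda>(c, x). c *\<^sub>C x)"
    proof (rule into)
      fix Y assume Y: "ind_compatible F Y"
      have 1: "continuous_map (prod_topology euclidean T) (prod_topology euclidean Y)
          (\<lambda>z :: complex \<times> cseq. (fst z, snd z))"
        by (intro continuous_map_pairedI
            continuous_map_compose[OF _ idc[OF Y], unfolded o_def] continuous_map_fst continuous_map_snd)
      have 2: "continuous_map (prod_topology euclidean Y) Y (\<lambda>(c, x). c *\<^sub>C x)"
        using lc[OF Y] by (simp add: lc_Hausdorff_def)
      show "continuous_map (prod_topology euclidean T) Y (\<lambda>(c, x). c *\<^sub>C x)"
        using continuous_map_compose[OF 1 2] by (simp add: o_def case_prod_beta')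
    qed
    show "Hausdorff_space T"
      unfolding Hausdorff_space_def
    proof (intro allI impI)
      fix x y assume "x \<in> topspace T \<and> y \<in> topspace T \<and> x \<noteq> y"
      then have "x \<in> topspace Y0 \<and> y \<in> topspace Y0 \<and> x \<noteq> y" using topT Tsp[OF Y0] by simp
      moreover have "Hausdorff_space Y0" using lc[OF Y0] by (simp add: lc_Hausdorff_def)
      ultimately show "\<exists>U V. openin T U \<and> openin T V \<and> x \<in> U \<and> y \<in> V \<and> disjnt U V"
        unfolding Hausdorff_space_def using finer[OF Y0] by meson
    qed
  next
    fix U assume U: "openin T U \<and> 0 \<in> U"
    have "generate_topology_on S U"
      using U by (simp add: T_def openin_topology_generated_by_iff)
    then have "0 \<in> U \<longrightarrow> (\<exists>V. openin T V \<and> 0 \<in> V \<and> V \<subseteq> U \<and> cseq_convex V)"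
    proof (induction rule: generate_topology_on.induct)
      case Empty
      then show ?case by simp
    next
      case (Int a b)
      show ?case
      proof
        assume "0 \<in> a \<inter> b"
        then obtain V W where
          "openin T V" "0 \<in> V" "V \<subseteq> a" "cseq_convex V"
          "openin T W" "0 \<in> W" "W \<subseteq> b" "cseq_convex W"
          using Int by blast
        then show "\<exists>V. openin T V \<and> 0 \<in> V \<and> V \<subseteq> a \<inter> b \<and> cseq_convex V"
          by (intro exI[of _ "V \<inter> W"]) (auto simp: cseq_convex_def)
      qed
    next
      case (UN K)
      then show ?case by (meson Union_iff Sup_upper subset_trans)
    next
      case (Basis s)
      then obtain Y where Y: "ind_compatible F Y" "openin Y s" by (auto simp: S_def)
      then show ?case using lc[OF Y(1)] finer[OF Y(1)] unfolding lc_Hausdorff_def by meson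
    qed
    then show "\<exists>V. openin T V \<and> 0 \<in> V \<and> V \<subseteq> U \<and> cseq_convex V" using U by blast
  qed
  moreover have "continuous_map (F k) T (\<lambda>x. x)" for k
    by (rule into) (simp add: ind_compatible_def)
  ultimately have "is_ind_lim F T"
    unfolding is_ind_lim_def using topT finer by (auto simp: ind_compatible_def E_def)
  then show ?thesis using ind_lim_eq by metis
qed

lemma c0_subspace: "cseq.subspace (c0 w)"
proof (rule cseq.subspaceI)
  show "0 \<in> c0 w" by (simp add: c0_def)
next
  fix x y assume x: "x \<in> c0 w" and y: "y \<in> c0 w"
  have abs: "(\<lambda>n. \<bar>w n\<bar> * cmod (z n)) \<longlonglongrightarrow> 0" if "z \<in> c0 w" for z
  proof -
    have "(\<lambda>n. \<bar>w n * cmod (z n)\<bar>) \<longlonglongrightarrow> 0"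
      using that unfolding c0_def mem_Collect_eq by (rule tendsto_rabs_zero)
    then show ?thesis by (simp only: abs_mult abs_norm_cancel)
  qed
  have "(\<lambda>n. \<bar>w n\<bar> * cmod (x n) + \<bar>w n\<bar> * cmod (y n)) \<longlonglongrightarrow> 0"
    using tendsto_add_zero[OF abs[OF x] abs[OF y]] .
  moreover have "norm (w n * cmod ((x + y) n)) \<le> \<bar>w n\<bar> * cmod (x n) + \<bar>w n\<bar> * cmod (y n)" for n
    using mult_left_mono[OF norm_triangle_ineq[of "x n" "y n"] abs_ge_zero[of "w n"]]
    by (simp add: abs_mult distrib_left)
  ultimately show "x + y \<in> c0 w"
    unfolding c0_def mem_Collect_eq
    by (rule Lim_null_comparison[OF always_eventually[OF allI], rotated])
next
  fix c x assume "x \<in> c0 w"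
  then have "(\<lambda>n. cmod c * (w n * cmod (x n))) \<longlonglongrightarrow> 0"
    unfolding c0_def mem_Collect_eq by (rule tendsto_mult_right_zero)
  moreover have "(\<lambda>n. cmod c * (w n * cmod (x n))) = (\<lambda>n. w n * cmod ((c *\<^sub>C x) n))"
    by (simp add: fun_eq_iff cscale_def norm_mult)
  ultimately show "c *\<^sub>C x \<in> c0 w"
    unfolding c0_def mem_Collect_eq by metis
qed

lemma c0_norm_bound:
  assumes "x \<in> c0 w" shows "w n * cmod (x n) \<le> c0_norm w x"
proof -
  have "bdd_above (range (\<lambda>n. w n * cmod (x n)))"
    using assms convergent_imp_bounded[of "\<lambda>n. w n * cmod (x n)" 0]
    by (simp add: c0_def bounded_imp_bdd_above)
  then show ?thesis using assms by (auto simp: c0_norm_def intro: cSUP_upper)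
qed

lemma c0_norm_nonneg:
  assumes "\<And>n. 0 < w n" shows "0 \<le> c0_norm w x"
proof (cases "x \<in> c0 w")
  case True
  have "0 \<le> w 0 * cmod (x 0)" using assms[of 0] by simp
  then show ?thesis using c0_norm_bound[OF True, of 0] by linarith
qed (simp add: c0_norm_def)

lemma c0_norm_least:
  assumes "x \<in> c0 w" "\<And>n. w n * cmod (x n) \<le> B" shows "c0_norm w x \<le> B"
  using assms by (auto simp: c0_norm_def intro: cSUP_least)

lemma c0_Metric_space:
  assumes w: "\<And>n. 0 < w n"
  shows "Metric_space (c0 w) (\<lambda>x y. c0_norm w (x - y))"
proof
  fix x y show "0 \<le> c0_norm w (x - y)" by (rule c0_norm_nonneg[OF w])
next
  fix x y :: cseq
  have "(x - y \<in> c0 w) = (y - x \<in> c0 w)" by (simp add: c0_def norm_minus_commute)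
  then show "c0_norm w (x - y) = c0_norm w (y - x)"
    by (simp add: c0_norm_def norm_minus_commute)
next
  fix x y assume xy: "x \<in> c0 w" "y \<in> c0 w"
  then have d: "x - y \<in> c0 w" by (rule cseq.subspace_diff[OF c0_subspace])
  show "(c0_norm w (x - y) = 0) = (x = y)"
  proof
    assume 0: "c0_norm w (x - y) = 0"
    have "x n = y n" for n
    proof -
      have "w n * cmod (x n - y n) \<le> 0" using c0_norm_bound[OF d, of n] 0 by simp
      then show ?thesis using w[of n] by (simp add: mult_le_0_iff)
    qed
    then show "x = y" by auto
  next
    assume "x = y"
    then have "c0_norm w (x - y) \<le> 0" using d by (intro c0_norm_least) auto
    then show "c0_norm w (x - y) = 0" using c0_norm_nonneg[where w = w and x = "x - y", OF w] by linarith
  qed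
next
  fix x y z assume xyz: "x \<in> c0 w" "y \<in> c0 w" "z \<in> c0 w"
  have d: "x - y \<in> c0 w" "y - z \<in> c0 w" "x - z \<in> c0 w"
    using xyz by (auto intro: cseq.subspace_diff[OF c0_subspace])
  show "c0_norm w (x - z) \<le> c0_norm w (x - y) + c0_norm w (y - z)"
  proof (rule c0_norm_least[OF d(3)])
    fix n
    have "cmod ((x - z) n) \<le> cmod ((x - y) n) + cmod ((y - z) n)"
      using norm_triangle_ineq[of "x n - y n" "y n - z n"] by simp
    then have "w n * cmod ((x - z) n) \<le> w n * (cmod ((x - y) n) + cmod ((y - z) n))"
      using w[of n] by (intro mult_left_mono) auto
    then show "w n * cmod ((x - z) n) \<le> c0_norm w (x - y) + c0_norm w (y - z)"
      using c0_norm_bound[OF d(1), of n] c0_norm_bound[OF d(2), of n]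
      by (simp add: distrib_left)
  qed
qed

lemma topspace_c0_topology: "(\<And>n. 0 < w n) \<Longrightarrow> topspace (c0_topology w) = c0 w"
  unfolding c0_topology_def by (intro Metric_space.topspace_mtopology c0_Metric_space)

lemma open_cseq_box:
  assumes "open U" "(x :: cseq) \<in> U"
  obtains N \<epsilon> where "0 < \<epsilon>" "\<forall>y. (\<forall>n<N. cmod (y n - x n) < \<epsilon>) \<longrightarrow> y \<in> U"
proof -
  have "openin (product_topology (\<lambda>i. euclidean) UNIV) U" using assms(1) by (simp add: open_fun_def)
  from product_topology_open_contains_basis[OF this assms(2)]
  obtain X where X: "x \<in> (\<Pi>\<^sub>E i\<in>UNIV. X i)" "\<And>i. openin euclidean (X i)"
    "finite {i. X i \<noteq> topspace euclidean}" "(\<Pi>\<^sub>E i\<in>UNIV. X i) \<subseteq> U" by blast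
  let ?I = "{i. X i \<noteq> UNIV}"
  have fin: "finite ?I" using X(3) by simp
  have "\<forall>i. \<exists>e>0. ball (x i) e \<subseteq> X i"
    using X(1,2) by (auto simp: PiE_def Pi_def open_contains_ball)
  then obtain e where e: "\<And>i. 0 < e i" "\<And>i. ball (x i) (e i) \<subseteq> X i" by metis
  define \<epsilon> where "\<epsilon> = Min (insert 1 (e ` ?I))"
  have pos: "0 < \<epsilon>" unfolding \<epsilon>_def using fin e by (subst Min_gr_iff) auto
  obtain N where N: "\<And>i. i \<in> ?I \<Longrightarrow> i < N"
    using finite_nat_bounded[OF fin] by auto
  have "y \<in> U" if y: "\<forall>n<N. cmod (y n - x n) < \<epsilon>" for y
  proof -
    have "y i \<in> X i" for i
    proof (cases "i \<in> ?I")
      case True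
      then have "\<epsilon> \<le> e i" unfolding \<epsilon>_def using fin by (intro Min_le) auto
      then have "y i \<in> ball (x i) (e i)"
        using y[rule_format, OF N[OF True]] by (simp add: dist_norm norm_minus_commute)
      then show ?thesis using e(2) by blast
    qed simp
    then show ?thesis using X(4) by auto
  qed
  with pos show thesis by (intro that) blast+
qed

lemma lc_Hausdorff_pointwise:
  assumes E: "cseq.subspace E" shows "lc_Hausdorff (top_of_set E)"
  unfolding lc_Hausdorff_def
proof (intro conjI allI impI)
  have cont_n: "continuous_on A (\<lambda>z. f z n)" if "continuous_on A f" for A f and n :: nat
    using that by (rule continuous_on_product_then_coordinatewise)
  show "cseq.subspace (topspace (top_of_set E))" using E by simp
  have pt: "prod_topology (top_of_set A) (top_of_set B) = top_of_set (A \<times> B)"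
    for A :: "'c::topological_space set" and B :: "'d::topological_space set"
    using subtopology_Times[of euclidean euclidean A B] by simp
  have "continuous_on (E \<times> E) (\<lambda>z :: cseq \<times> cseq. fst z + snd z)"
    unfolding plus_fun_def
    by (rule continuous_on_coordinatewise_then_product, rule continuous_on_add,
        rule cont_n[OF continuous_on_fst[OF continuous_on_id]],
        rule cont_n[OF continuous_on_snd[OF continuous_on_id]])
  moreover have "(\<lambda>z. fst z + snd z) \<in> E \<times> E \<rightarrow> E"
    using cseq.subspace_add[OF E] by auto
  ultimately show "continuous_map (prod_topology (top_of_set E) (top_of_set E)) (top_of_set E) (\<lambda>(x, y). x + y)"
    unfolding case_prod_beta' pt continuous_map_subtopology_eu by (simp add: image_subset_iff_funcset)
  have "continuous_on (UNIV \<times> E) (\<lambda>z :: complex \<times> cseq. fst z *\<^sub>C snd z)"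
    unfolding cscale_def
    by (rule continuous_on_coordinatewise_then_product, rule continuous_on_mult,
        rule continuous_on_fst[OF continuous_on_id],
        rule cont_n[OF continuous_on_snd[OF continuous_on_id]])
  moreover have "(\<lambda>z. fst z *\<^sub>C snd z) \<in> UNIV \<times> E \<rightarrow> E"
    using cseq.subspace_scale[OF E] by auto
  ultimately show "continuous_map (prod_topology euclidean (top_of_set E)) (top_of_set E) (\<lambda>(c, x). c *\<^sub>C x)"
    using pt[of "UNIV :: complex set" E]
    unfolding case_prod_beta' subtopology_UNIV by (simp add: image_subset_iff_funcset)
  show "Hausdorff_space (top_of_set E)" by (intro Hausdorff_space_subtopology) simp
next
  fix U assume U: "openin (top_of_set E) U \<and> 0 \<in> U"
  then obtain W where W: "open W" "U = E \<inter> W" by (auto simp: openin_open)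
  with U have W0: "0 \<in> W" by auto
  obtain N \<epsilon>
    where N: "0 < \<epsilon>" "\<forall>y. (\<forall>n<N. cmod (y n - 0 n) < \<epsilon>) \<longrightarrow> y \<in> W"
    using open_cseq_box[OF W(1) W0] by metis
  define B where "B = (\<Inter>n<N. {y :: cseq. cmod (y n) < \<epsilon>})"
  have cn: "continuous_on UNIV (\<lambda>y :: cseq. cmod (y n))" for n
    by (intro continuous_on_norm continuous_on_product_coordinates)
  have "open B"
    unfolding B_def
    by (intro open_INT ballI open_Collect_less cn) (auto intro: continuous_on_const)
  then have "openin (top_of_set E) (E \<inter> B)" by (rule openin_open_Int)
  moreover have "0 \<in> E \<inter> B" using N(1) cseq.subspace_0[OF E] by (simp add: B_def)
  moreover have "B \<subseteq> W"
  proof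
    fix y assume "y \<in> B"
    then show "y \<in> W" by (intro N(2)[rule_format]) (simp add: B_def)
  qed
  then have "E \<inter> B \<subseteq> U" using W(2) by blast
  moreover have "cseq_convex (E \<inter> B)"
    unfolding cseq_convex_def
  proof (intro ballI allI impI)
    fix x y t assume x: "x \<in> E \<inter> B" and y: "y \<in> E \<inter> B" and t: "0 \<le> (t::real) \<and> t \<le> 1"
    have "cmod (of_real (1 - t) * x n + of_real t * y n) < \<epsilon>" if "n < N" for n
    proof -
      have "cmod (x n) < \<epsilon>" "cmod (y n) < \<epsilon>" using x y that by (auto simp: B_def)
      then have "(1 - t) * cmod (x n) + t * cmod (y n) < \<epsilon>" using t by (intro convex_bound_lt) auto
      moreover have "cmod (of_real (1 - t) * x n + of_real t * y n) \<le> (1 - t) * cmod (x n) + t * cmod (y n)"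
        using t by (intro norm_triangle_le) (simp add: norm_mult del: of_real_diff)
      ultimately show ?thesis by linarith
    qed
    then show "of_real (1 - t) *\<^sub>C x + of_real t *\<^sub>C y \<in> E \<inter> B"
      using x y cseq.subspace_add[OF E] cseq.subspace_scale[OF E]
      by (simp add: B_def cscale_def del: of_real_diff)
  qed
  ultimately show "\<exists>V. openin (top_of_set E) V \<and> 0 \<in> V \<and> V \<subseteq> U \<and> cseq_convex V" by blast
qed

lemma E_weight_pos: "1 < s k \<Longrightarrow> 0 < E_weight \<alpha> s k n"
  by (simp add: E_weight_def)

lemma c0_E_weight_mono:
  assumes "\<And>n. 0 < \<alpha> n" "\<And>k. 1 < s k" "strict_mono s" "k \<le> l"
  shows "c0 (E_weight \<alpha> s k) \<subseteq> c0 (E_weight \<alpha> s l)"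
proof
  fix x assume x: "x \<in> c0 (E_weight \<alpha> s k)"
  have "s k \<le> s l" using assms(3,4) by (simp add: strict_mono_less_eq)
  then have "E_weight \<alpha> s l n \<le> E_weight \<alpha> s k n" for n
    unfolding E_weight_def using assms(1)[of n] assms(2)[of k]
    by (intro powr_mono2') auto
  then have "norm (E_weight \<alpha> s l n * cmod (x n)) \<le> E_weight \<alpha> s k n * cmod (x n)" for n
    by (simp add: abs_mult mult_right_mono E_weight_def)
  then show "x \<in> c0 (E_weight \<alpha> s l)"
    using x unfolding c0_def mem_Collect_eq
    by (rule Lim_null_comparison[OF always_eventually[OF allI]])
qed

theorem is_ind_lim_E_space:
  assumes "\<And>n. 0 < \<alpha> n" "\<And>k. 1 < s k" "strict_mono s"
  shows "is_ind_lim (\<lambda>k. c0_topology (E_weight \<alpha> s k)) (E_space \<alpha> s)"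
  unfolding E_space_def
proof (rule is_ind_lim_ind_lim)
  let ?w = "E_weight \<alpha> s"
  let ?E = "\<Union>k. c0 (?w k)"
  have wpos: "0 < ?w k n" for k n using assms(2) by (rule E_weight_pos)
  have top: "topspace (c0_topology (?w k)) = c0 (?w k)" for k
    by (rule topspace_c0_topology) (rule wpos)
  have sub: "cseq.subspace ?E"
  proof (rule cseq.subspaceI)
    show "0 \<in> ?E" using cseq.subspace_0[OF c0_subspace] by blast
  next
    fix x y assume "x \<in> ?E" "y \<in> ?E"
    then obtain k l where "x \<in> c0 (?w k)" "y \<in> c0 (?w l)" by blast
    then have "x \<in> c0 (?w (max k l))" "y \<in> c0 (?w (max k l))"
      using c0_E_weight_mono[where \<alpha> = \<alpha> and s = s, OF assms] max.cobounded1 max.cobounded2 by blast+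
    then show "x + y \<in> ?E" using cseq.subspace_add[OF c0_subspace] by blast
  next
    fix c x assume "x \<in> ?E"
    then show "c *\<^sub>C x \<in> ?E" using cseq.subspace_scale[OF c0_subspace] by blast
  qed
  have cont: "continuous_map (c0_topology (?w k)) (top_of_set ?E) (\<lambda>x. x)" for k
  proof -
    interpret M: Metric_space "c0 (?w k)" "\<lambda>x y. c0_norm (?w k) (x - y)"
      by (rule c0_Metric_space) (rule wpos)
    have "continuous_map (c0_topology (?w k)) euclidean (\<lambda>x. x)"
      unfolding continuous_map_def
    proof (intro conjI allI impI)
      show "(\<lambda>x. x) \<in> topspace (c0_topology (?w k)) \<rightarrow> topspace euclidean" by simp
      fix U :: "cseq set" assume "openin euclidean U"
      then have U: "open U" by simp
      have "openin M.mtopology (c0 (?w k) \<inter> U)"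
        unfolding M.openin_mtopology
      proof (intro conjI allI impI)
        fix x assume x: "x \<in> c0 (?w k) \<inter> U"
        obtain N \<epsilon>
          where N: "0 < \<epsilon>" "\<forall>y. (\<forall>n<N. cmod (y n - x n) < \<epsilon>) \<longrightarrow> y \<in> U"
          using open_cseq_box[OF U, of x] x by (metis IntD2)
        define r where "r = Min (insert 1 ((\<lambda>n. \<epsilon> * ?w k n) ` {..<N}))"
        have "0 < r" unfolding r_def using N(1) wpos by (subst Min_gr_iff) auto
        moreover have "M.mball x r \<subseteq> c0 (?w k) \<inter> U"
        proof
          fix y assume y: "y \<in> M.mball x r"
          then have d: "x - y \<in> c0 (?w k)" and lt: "c0_norm (?w k) (x - y) < r"
            using cseq.subspace_diff[OF c0_subspace] by auto
          have "cmod (y n - x n) < \<epsilon>" if "n < N" for n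
          proof -
            have "?w k n * cmod (x n - y n) < r"
              using c0_norm_bound[OF d, of n] lt by simp
            also have "r \<le> \<epsilon> * ?w k n" unfolding r_def using that by (intro Min_le) auto
            finally show ?thesis using wpos[of k n] by (simp add: mult.commute norm_minus_commute)
          qed
          then show "y \<in> c0 (?w k) \<inter> U" using N(2) y by auto
        qed
        ultimately show "\<exists>r>0. M.mball x r \<subseteq> c0 (?w k) \<inter> U" by blast
      qed auto
      moreover have "{x \<in> topspace (c0_topology (?w k)). x \<in> U} = c0 (?w k) \<inter> U"
        using top by auto
      ultimately show "openin (c0_topology (?w k)) {x \<in> topspace (c0_topology (?w k)). x \<in> U}"
        by (simp add: c0_topology_def)
    qed
    then show ?thesis using top by (auto simp: continuous_map_in_subtopology)
  qed
  show "ind_compatible (\<lambda>k. c0_topology (?w k)) (top_of_set ?E)"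
    unfolding ind_compatible_def using lc_Hausdorff_pointwise[OF sub] cont top by simp
qed

end

theory Submission
  imports Defs
begin

text \<open>
  Write \<open>E\<close> for \<open>E\<^sub>\<alpha>\<close>. Nuclearity enters through a single inequality: there is an \<open>M\<close> with
  \<open>ln n \<le> M \<alpha>\<^sub>n\<close> for all \<open>n\<close> (lemma \<open>ln_Suc_le_alpha\<close>). Then \<open>n\<^sup>K s\<^sub>k\<^bsup>\<alpha>\<^sub>n\<^esup> \<le> s\<^sub>l\<^bsup>\<alpha>\<^sub>n\<^esup>\<close> for a
  suitable \<open>l\<close> (lemma \<open>power_absorbed\<close>), so polynomial factors are invisible in \<open>E\<close>. This has three
  consequences.

  \<^item> The eigenvector of the Cesaro operator \<open>C\<close> for \<open>1/m\<close>, a column of the Pascal triangle, grows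
    polynomially and hence belongs to \<open>E\<close>. So all of \<open>\<Sigma>\<close> consists of eigenvalues.

  \<^item> The topology of \<open>E\<close> is given by the norms \<open>x \<mapsto> \<Sum>n. a\<^sub>n \<bar>x\<^sub>n\<bar>\<close>, where \<open>a\<close> runs through the positive
    sequences with \<open>\<Sum>n. a\<^sub>n s\<^sub>k\<^bsup>\<alpha>\<^sub>n\<^esup> < \<infinity>\<close> for every \<open>k\<close> (lemmas \<open>openin_l1_ball\<close> and
    \<open>nbhd_contains_l1_ball\<close>).

  \<^item> A set of linear maps \<open>T\<close> with \<open>\<bar>(T x)\<^sub>n\<bar> \<le> B n\<^sup>K (\<bar>x\<^sub>1\<bar> + \<dots> + \<bar>x\<^sub>n\<bar>)\<close>, with the same \<open>B\<close> and \<open>K\<close> for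
    the whole set, is equicontinuous on \<open>E\<close>: summing by columns moves the factor \<open>n\<^sup>K\<close> and the sum
    into the weight \<open>a\<close> (lemmas \<open>poly_causal_l1_bound\<close> and \<open>equicontinuous_poly_causal\<close>).

  For \<open>\<lambda> \<notin> \<Sigma>\<close> the equation \<open>\<lambda> x - C x = y\<close> is a first order recursion for the partial sums
  \<open>S\<^sub>n = x\<^sub>1 + \<dots> + x\<^sub>n\<close>, namely \<open>(\<lambda> - 1/n) S\<^sub>n = y\<^sub>n + \<lambda> S\<^sub>n\<^sub>-\<^sub>1\<close>. If \<open>\<bar>\<lambda> - 1/n\<bar> \<ge> d > 0\<close> for all \<open>n\<close>, its
  multipliers have modulus at most \<open>1 + 1/(d n)\<close>, whose products grow like \<open>n\<close> to the power \<open>1/d\<close>.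
  So the inverse satisfies an estimate as above, in which \<open>B\<close> and \<open>K\<close> depend only on \<open>d\<close>, hence are
  common to a neighbourhood of any \<open>\<lambda> \<notin> \<Sigma>\<^sub>0\<close>; this gives \<open>\<sigma>\<^sup>* \<subseteq> \<Sigma>\<^sub>0\<close>. For \<open>\<lambda> = 0\<close> the recursion has
  no memory, \<open>S\<^sub>n = - n y\<^sub>n\<close>, so \<open>0\<close> lies in the resolvent set; it lies in \<open>\<sigma>\<^sup>*\<close> all the same, because
  it is a limit of the eigenvalues \<open>1/n\<close>.

  The inequality \<open>ln n \<le> M \<alpha>\<^sub>n\<close> comes from a trace argument. If the canonical map from a continuous
  seminorm \<open>q\<close> to the norm \<open>sup\<^sub>n w\<^sub>n \<bar>x\<^sub>n\<bar>\<close> is nuclear, the diagonal entries of its series are all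
  equal to 1, and weighting them with \<open>w\<close> shows \<open>\<Sum>n. w\<^sub>n < \<infinity>\<close> (lemma \<open>nuclear_imp_weights_summable\<close>).
  If \<open>ln n / \<alpha>\<^sub>n\<close> were unbounded, the weights \<open>w\<^sub>n = exp (- \<phi>\<^sub>n \<alpha>\<^sub>n / 2)\<close> with
  \<open>\<phi>\<^sub>n = max\<^sub>i\<^sub>\<le>\<^sub>n ln i / \<alpha>\<^sub>i\<close> would be admissible but not summable.
\<close>

section \<open>Normed sequence spaces\<close>

text \<open>
  A norm on a sequence space is given here as a total function of which only the values on \<open>E\<close> count.
  The locale turns it into a locally convex Hausdorff topology; such topologies are the test objects
  against which the inductive limit topology is the finest.
\<close>

locale normed_cseq_space =
  fixes E :: "cseq set" and q :: "cseq \<Rightarrow> real"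
  assumes subspace: "cseq.subspace E"
    and nonneg: "x \<in> E \<Longrightarrow> 0 \<le> q x"
    and zero: "x \<in> E \<Longrightarrow> q x = 0 \<Longrightarrow> x = 0"
    and triangle: "x \<in> E \<Longrightarrow> y \<in> E \<Longrightarrow> q (x + y) \<le> q x + q y"
    and scale: "x \<in> E \<Longrightarrow> q (c *\<^sub>C x) = cmod c * q x"
begin

text \<open>
  The value 0 outside \<open>E\<close> keeps the distance non-negative and symmetric everywhere, as
  \<^locale>\<open>Metric_space\<close> demands.
\<close>

definition norm_dist :: "cseq \<Rightarrow> cseq \<Rightarrow> real" where
  "norm_dist x y = (if x \<in> E \<and> y \<in> E then q (x - y) else 0)"

definition norm_topology :: "cseq topology" where
  "norm_topology = Metric_space.mtopology E norm_dist"

lemma diff_mem: "x \<in> E \<Longrightarrow> y \<in> E \<Longrightarrow> x - y \<in> E"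
  by (rule cseq.subspace_diff[OF subspace])

lemma add_mem: "x \<in> E \<Longrightarrow> y \<in> E \<Longrightarrow> x + y \<in> E"
  by (rule cseq.subspace_add[OF subspace])

lemma scale_mem: "x \<in> E \<Longrightarrow> c *\<^sub>C x \<in> E"
  by (rule cseq.subspace_scale[OF subspace])

lemma norm_0: "q 0 = 0"
  using scale[OF cseq.subspace_0[OF subspace], of 0] by simp

lemma norm_minus_commute:
  assumes "x \<in> E" "y \<in> E" shows "q (x - y) = q (y - x)"
proof -
  have "y - x = (-1) *\<^sub>C (x - y)" by (simp add: cscale_def fun_eq_iff)
  then show ?thesis using scale[OF diff_mem[OF assms], of "-1"] by simp
qed

lemma norm_uminus: "x \<in> E \<Longrightarrow> q (- x) = q x"
  using norm_minus_commute[OF cseq.subspace_0[OF subspace], of x] by simp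

lemma triangle_diff:
  assumes "x \<in> E" "y \<in> E" "z \<in> E" shows "q (x - z) \<le> q (x - y) + q (y - z)"
  using triangle[OF diff_mem[OF assms(1,2)] diff_mem[OF assms(2,3)]] by simp

lemma Metric_space_norm: "Metric_space E norm_dist"
proof
  fix x y z
  show "0 \<le> norm_dist x y" by (simp add: norm_dist_def nonneg diff_mem)
  show "norm_dist x y = norm_dist y x" by (simp add: norm_dist_def norm_minus_commute)
  assume "x \<in> E" "y \<in> E"
  then show "(norm_dist x y = 0) = (x = y)"
    using zero[of "x - y"] diff_mem norm_0 by (auto simp: norm_dist_def)
  assume "z \<in> E"
  with \<open>x \<in> E\<close> \<open>y \<in> E\<close> show "norm_dist x z \<le> norm_dist x y + norm_dist y z"
    by (simp add: norm_dist_def triangle_diff)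
qed

lemma topspace_norm_topology: "topspace norm_topology = E"
  unfolding norm_topology_def by (rule Metric_space.topspace_mtopology[OF Metric_space_norm])

lemma openin_norm_topology:
  "openin norm_topology U \<longleftrightarrow> U \<subseteq> E \<and> (\<forall>x\<in>U. \<exists>r>0. \<forall>y\<in>E. q (x - y) < r \<longrightarrow> y \<in> U)"
proof -
  interpret M: Metric_space E norm_dist by (rule Metric_space_norm)
  have "M.mball x r \<subseteq> U \<longleftrightarrow> (\<forall>y\<in>E. q (x - y) < r \<longrightarrow> y \<in> U)" if "x \<in> E" for x r
    using that by (auto simp: M.mball_def norm_dist_def)
  then have "(\<exists>r>0. M.mball x r \<subseteq> U) \<longleftrightarrow> (\<exists>r>0. \<forall>y\<in>E. q (x - y) < r \<longrightarrow> y \<in> U)"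
    if "x \<in> E" for x
    using that by simp
  then show ?thesis
    unfolding norm_topology_def M.openin_mtopology Ball_def[of U] by (auto 0 0 simp: subset_iff)
qed

lemma openin_norm_ball:
  assumes x: "x \<in> E" shows "openin norm_topology {y \<in> E. q (x - y) < r}"
  unfolding openin_norm_topology
proof (intro conjI ballI)
  fix y assume y: "y \<in> {y \<in> E. q (x - y) < r}"
  have "q (x - z) < r" if "z \<in> E" "q (y - z) < r - q (x - y)" for z
    using triangle_diff[OF x _ that(1), of y] y that(2) by simp
  then show "\<exists>e>0. \<forall>z\<in>E. q (y - z) < e \<longrightarrow> z \<in> {y \<in> E. q (x - y) < r}"
    using y by (intro exI[of _ "r - q (x - y)"]) auto
qed auto

lemma continuous_norm: "continuous_map norm_topology euclideanreal q"
  unfolding continuous_map_def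
proof (intro conjI allI impI)
  fix U :: "real set" assume "openin euclidean U"
  then have U: "open U" by simp
  show "openin norm_topology {x \<in> topspace norm_topology. q x \<in> U}"
    unfolding openin_norm_topology topspace_norm_topology
  proof (intro conjI ballI)
    fix x assume x: "x \<in> {x \<in> E. q x \<in> U}"
    then obtain e where e: "e > 0" "\<And>t. dist t (q x) < e \<Longrightarrow> t \<in> U"
      using U x unfolding open_dist by fastforce
    have "q y \<in> U" if y: "y \<in> E" "q (x - y) < e" for y
    proof (rule e(2))
      have "q y \<le> q x + q (x - y)" "q x \<le> q y + q (x - y)"
        using triangle[of "y - x" x] triangle[of "x - y" y] x y norm_minus_commute[of y x] diff_mem[of x y]
          diff_mem[of y x] by simp_all
      then show "dist (q y) (q x) < e" using y by (simp add: dist_real_def)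
    qed
    then show "\<exists>r>0. \<forall>y\<in>E. q (x - y) < r \<longrightarrow> y \<in> {x \<in> E. q x \<in> U}" using e(1) by auto
  qed auto
qed auto


lemma openin_norm_topologyD:
  "openin norm_topology U \<Longrightarrow> x \<in> U \<Longrightarrow> \<exists>r>0. \<forall>y\<in>E. q (x - y) < r \<longrightarrow> y \<in> U"
  by (simp add: openin_norm_topology)

lemma lc_Hausdorff_norm_topology: "lc_Hausdorff norm_topology"
  unfolding lc_Hausdorff_def
proof (intro conjI allI impI)
  show "cseq.subspace (topspace norm_topology)" by (simp add: topspace_norm_topology subspace)
  show "Hausdorff_space norm_topology"
    unfolding norm_topology_def by (rule Metric_space.Hausdorff_space_mtopology[OF Metric_space_norm])
  show "continuous_map (prod_topology norm_topology norm_topology) norm_topology (\<lambda>(x, y). x + y)"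
    unfolding continuous_map_def
  proof (intro conjI allI impI)
    fix U assume U: "openin norm_topology U"
    show "openin (prod_topology norm_topology norm_topology)
        {z \<in> topspace (prod_topology norm_topology norm_topology). (case z of (x, y) \<Rightarrow> x + y) \<in> U}"
      unfolding openin_prod_topology_alt
    proof (intro allI impI)
      fix x y assume "(x, y) \<in> {z \<in> topspace (prod_topology norm_topology norm_topology).
        (case z of (x, y) \<Rightarrow> x + y) \<in> U}"
      then have xy: "x \<in> E" "y \<in> E" "x + y \<in> U" by (auto simp: topspace_norm_topology)
      then obtain r where r: "r > 0" "\<And>z. z \<in> E \<Longrightarrow> q (x + y - z) < r \<Longrightarrow> z \<in> U"
        using openin_norm_topologyD[OF U] by (metis (no_types))
      define V W where "V = {z \<in> E. q (x - z) < r / 2}" and "W = {z \<in> E. q (y - z) < r / 2}"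
      have sub: "V \<subseteq> E" "W \<subseteq> E" by (auto simp: V_def W_def)
      have add: "x' + y' \<in> U" if "x' \<in> V" "y' \<in> W" for x' y'
      proof (rule r(2))
        have "q ((x - x') + (y - y')) < r"
          using triangle[of "x - x'" "y - y'"] diff_mem[of x x'] diff_mem[of y y'] that xy
          unfolding V_def W_def by auto
        then show "q (x + y - (x' + y')) < r" by (simp add: add_diff_add)
      qed (use that sub in \<open>auto intro: add_mem\<close>)
      show "\<exists>V W. openin norm_topology V \<and> openin norm_topology W \<and> x \<in> V \<and> y \<in> W \<and>
          V \<times> W \<subseteq> {z \<in> topspace (prod_topology norm_topology norm_topology).
            (case z of (x, y) \<Rightarrow> x + y) \<in> U}"
      proof (intro exI conjI)
        show "openin norm_topology V" "openin norm_topology W"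
          unfolding V_def W_def by (rule openin_norm_ball[OF xy(1)], rule openin_norm_ball[OF xy(2)])
        show "x \<in> V" "y \<in> W" using xy r(1) norm_0 by (simp_all add: V_def W_def)
      qed (use sub add in \<open>auto simp: topspace_norm_topology\<close>)
    qed
  qed (auto simp: topspace_norm_topology intro: add_mem)
  show "continuous_map (prod_topology euclidean norm_topology) norm_topology (\<lambda>(c, x). c *\<^sub>C x)"
    unfolding continuous_map_def
  proof (intro conjI allI impI)
    fix U assume U: "openin norm_topology U"
    show "openin (prod_topology euclidean norm_topology)
        {z \<in> topspace (prod_topology euclidean norm_topology). (case z of (c, x) \<Rightarrow> c *\<^sub>C x) \<in> U}"
      unfolding openin_prod_topology_alt
    proof (intro allI impI)
      fix c x assume "(c, x) \<in> {z \<in> topspace (prod_topology euclidean norm_topology).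
        (case z of (c, x) \<Rightarrow> c *\<^sub>C x) \<in> U}"
      then have cx: "x \<in> E" "c *\<^sub>C x \<in> U" by (auto simp: topspace_norm_topology)
      then obtain r where r: "r > 0" "\<And>z. z \<in> E \<Longrightarrow> q (c *\<^sub>C x - z) < r \<Longrightarrow> z \<in> U"
        using openin_norm_topologyD[OF U] by (metis (no_types))
      \<comment> \<open>Split \<open>c x - c' x' = c (x - x') + (c - c') x'\<close>. If both distances are below \<open>e \<le> 1\<close>, then
        \<open>q x' \<le> q x + 1\<close>, so the norm is at most \<open>e (\<bar>c\<bar> + q x + 1)\<close>.\<close>
      define K where "K = cmod c + q x + 1"
      have K: "K > 0" unfolding K_def using nonneg[OF cx(1)] norm_ge_zero[of c] by linarith
      define e where "e = min 1 (r / (2 * K))"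
      have e: "0 < e" "e \<le> 1" "e * K < r"
        using K r(1) by (auto simp: e_def min_mult_distrib_right min_def field_simps)
      define W where "W = {z \<in> E. q (x - z) < e}"
      have mult: "c' *\<^sub>C x' \<in> U" if c': "c' \<in> ball c e" and "x' \<in> W" for c' x'
      proof (rule r(2))
        have x': "x' \<in> E" "q (x - x') < e" using that(2) by (auto simp: W_def)
        have "c *\<^sub>C x - c' *\<^sub>C x' = c *\<^sub>C (x - x') + (c - c') *\<^sub>C x'"
          by (simp add: fun_eq_iff cscale_def algebra_simps)
        then have "q (c *\<^sub>C x - c' *\<^sub>C x') \<le> cmod c * q (x - x') + cmod (c - c') * q x'"
          using triangle[of "c *\<^sub>C (x - x')" "(c - c') *\<^sub>C x'"] cx x'
          by (simp add: scale scale_mem diff_mem)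
        also have "\<dots> \<le> cmod c * e + e * (q x + 1)"
        proof (intro add_mono mult_mono mult_left_mono)
          show "q x' \<le> q x + 1"
            using triangle[of "x' - x" x] x' cx e(2) norm_minus_commute[of x x']
            by (auto simp: diff_mem)
          show "cmod (c - c') \<le> e" using c' by (simp add: dist_norm)
        qed (use x' cx e in \<open>auto intro!: nonneg diff_mem\<close>)
        also have "\<dots> = e * K" by (simp add: K_def algebra_simps)
        finally show "q (c *\<^sub>C x - c' *\<^sub>C x') < r" using e(3) by simp
      qed (use that in \<open>auto simp: W_def intro: scale_mem\<close>)
      show "\<exists>V W. openin euclidean V \<and> openin norm_topology W \<and> c \<in> V \<and> x \<in> W \<and>
          V \<times> W \<subseteq> {z \<in> topspace (prod_topology euclidean norm_topology).
            (case z of (c, x) \<Rightarrow> c *\<^sub>C x) \<in> U}"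
      proof (intro exI conjI)
        show "openin norm_topology W"
          unfolding W_def by (rule openin_norm_ball[OF cx(1)])
        show "x \<in> W" using cx e norm_0 by (simp add: W_def)
        show "openin euclidean (ball c e)" "c \<in> ball c e" using e by auto
        show "ball c e \<times> W \<subseteq> {z \<in> topspace (prod_topology euclidean norm_topology).
            (case z of (c, x) \<Rightarrow> c *\<^sub>C x) \<in> U}"
          using mult by (auto simp: topspace_norm_topology W_def)
      qed
    qed
  qed (auto simp: topspace_norm_topology intro: scale_mem)
next
  fix U assume "openin norm_topology U \<and> 0 \<in> U"
  then obtain r where r: "r > 0" "\<And>z. z \<in> E \<Longrightarrow> q (0 - z) < r \<Longrightarrow> z \<in> U"
    using openin_norm_topologyD by (metis (no_types))
  have 0: "0 \<in> E" by (rule cseq.subspace_0[OF subspace])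
  let ?V = "{z \<in> E. q z < r}"
  have V: "{z \<in> E. q (0 - z) < r} = ?V" by (auto simp: norm_uminus)
  have "cseq_convex ?V"
    unfolding cseq_convex_def
  proof (intro ballI allI impI)
    fix x y t assume x: "x \<in> ?V" and y: "y \<in> ?V" and t: "0 \<le> (t::real) \<and> t \<le> 1"
    then have "(1 - t) * q x + t * q y < r"
      by (intro convex_bound_lt) auto
    moreover have "cmod (of_real (1 - t)) = 1 - t" "cmod (of_real t) = t" using t by (simp_all add: norm_of_real del: of_real_diff)
    ultimately have "q (of_real (1 - t) *\<^sub>C x + of_real t *\<^sub>C y) < r"
      using triangle[of "of_real (1 - t) *\<^sub>C x" "of_real t *\<^sub>C y"] x y
      by (simp add: scale scale_mem del: of_real_diff)
    then show "of_real (1 - t) *\<^sub>C x + of_real t *\<^sub>C y \<in> ?V"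
      using x y by (simp add: scale_mem add_mem del: of_real_diff)
  qed
  then show "\<exists>V. openin norm_topology V \<and> 0 \<in> V \<and> V \<subseteq> U \<and> cseq_convex V"
    using openin_norm_ball[OF 0, of r] r 0 norm_0 unfolding V
    by (intro exI[of _ ?V]) (auto simp: norm_uminus)
qed

end

section \<open>The inductive limit and its steps\<close>

locale coechelon =
  fixes \<alpha> s :: "nat \<Rightarrow> real"
  assumes alpha_pos: "\<And>n. 0 < \<alpha> n"
    and alpha_mono: "strict_mono \<alpha>"
    and s_gt_1: "\<And>k. 1 < s k"
    and s_mono: "strict_mono s"
    and s_lim: "filterlim s at_top sequentially"
begin

abbreviation v :: "nat \<Rightarrow> nat \<Rightarrow> real" where "v \<equiv> E_weight \<alpha> s"
abbreviation X :: "cseq topology" where "X \<equiv> E_space \<alpha> s"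
abbreviation E :: "cseq set" where "E \<equiv> topspace X"

text \<open>
  The reciprocal of the weight \<open>v\<^sub>k\<close>: an element of \<open>c\<^sub>0(v\<^sub>k)\<close> is \<open>o(growth k)\<close>. All estimates on sequences
  are stated with it.
\<close>

definition growth :: "nat \<Rightarrow> nat \<Rightarrow> real" where "growth k n = s k powr \<alpha> n"

lemma v_pos: "0 < v k n"
  using s_gt_1 by (rule E_weight_pos)

lemma growth_pos: "0 < growth k n"
  using s_gt_1[of k] by (simp add: growth_def)

lemma growth_ge_1: "1 \<le> growth k n"
  using s_gt_1[of k] alpha_pos[of n] by (simp add: growth_def ge_one_powr_ge_zero)

lemma v_eq: "v k n = 1 / growth k n"
  by (simp add: E_weight_def growth_def powr_minus_divide)

lemma is_ind_lim_X: "is_ind_lim (\<lambda>k. c0_topology (v k)) X"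
  using alpha_pos s_gt_1 s_mono by (rule is_ind_lim_E_space)

lemma compatible_X: "ind_compatible (\<lambda>k. c0_topology (v k)) X"
  using is_ind_lim_X by (simp add: is_ind_lim_def)

lemma topspace_step: "topspace (c0_topology (v k)) = c0 (v k)"
  by (rule topspace_c0_topology) (rule v_pos)

lemma topspace_X: "E = (\<Union>k. c0 (v k))"
  using compatible_X by (simp add: ind_compatible_def topspace_step)

lemma step_subset: "c0 (v k) \<subseteq> E"
  by (auto simp: topspace_X)

lemma lc_Hausdorff_X: "lc_Hausdorff X"
  using compatible_X by (simp add: ind_compatible_def)

lemma subspace_X: "cseq.subspace E"
  using lc_Hausdorff_X by (simp add: lc_Hausdorff_def)

lemma mem_X_iff: "x \<in> E \<longleftrightarrow> (\<exists>k. x \<in> c0 (v k))"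
  by (auto simp: topspace_X)

lemma step_bound:
  assumes "x \<in> c0 (v k)" shows "cmod (x n) \<le> c0_norm (v k) x * growth k n"
  using c0_norm_bound[OF assms, of n] growth_pos[of k n] by (simp add: v_eq field_simps)

lemma openin_step:
  assumes "openin X V" "0 \<in> V"
  shows "\<exists>\<delta>>0. \<forall>x\<in>c0 (v k). c0_norm (v k) x < \<delta> \<longrightarrow> x \<in> V"
proof -
  interpret M: Metric_space "c0 (v k)" "\<lambda>x y. c0_norm (v k) (x - y)"
    by (rule c0_Metric_space) (rule v_pos)
  have "continuous_map (c0_topology (v k)) X (\<lambda>x. x)"
    using compatible_X by (simp add: ind_compatible_def)
  then have "openin M.mtopology {x \<in> c0 (v k). x \<in> V}"
    using assms(1) unfolding continuous_map_def topspace_step by (simp add: c0_topology_def)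
  moreover have "0 \<in> {x \<in> c0 (v k). x \<in> V}"
    using assms(2) cseq.subspace_0[OF c0_subspace] by simp
  ultimately obtain r where r: "r > 0" "M.mball 0 r \<subseteq> {x \<in> c0 (v k). x \<in> V}"
    unfolding M.openin_mtopology by meson
  show ?thesis
  proof (intro exI[of _ r] conjI ballI impI r(1))
    fix x assume x: "x \<in> c0 (v k)" "c0_norm (v k) x < r"
    have "c0_norm (v k) (0 - x) = c0_norm (v k) (x - 0)" by (rule M.commute)
    then have "x \<in> M.mball 0 r"
      using x cseq.subspace_0[OF c0_subspace] by (simp add: M.mball_def)
    then show "x \<in> V" using r(2) by auto
  qed
qed

text \<open>
  A norm that is bounded on the unit ball of every step defines a compatible topology, and the
  inductive limit topology is finer than each of these. This is how sets are shown to be open in \<open>E\<close>.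
\<close>

lemma openin_X_if_openin_norm:
  assumes "normed_cseq_space E q"
    and bound: "\<And>k. \<exists>D. \<forall>x\<in>c0 (v k). q x \<le> D * c0_norm (v k) x"
    and U: "openin (normed_cseq_space.norm_topology E q) U"
  shows "openin X U"
proof -
  interpret N: normed_cseq_space E q by (rule assms(1))
  have "continuous_map (c0_topology (v k)) N.norm_topology (\<lambda>x. x)" for k
    unfolding continuous_map_def
  proof (intro conjI allI impI)
    show "(\<lambda>x. x) \<in> topspace (c0_topology (v k)) \<rightarrow> topspace N.norm_topology"
      using step_subset by (auto simp: topspace_step N.topspace_norm_topology)
    fix U assume U: "openin N.norm_topology U"
    interpret M: Metric_space "c0 (v k)" "\<lambda>x y. c0_norm (v k) (x - y)"
      by (rule c0_Metric_space) (rule v_pos)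
    obtain D where D: "\<And>x. x \<in> c0 (v k) \<Longrightarrow> q x \<le> D * c0_norm (v k) x"
      using bound[of k] by blast
    have "openin M.mtopology (c0 (v k) \<inter> U)"
      unfolding M.openin_mtopology
    proof (intro conjI allI impI)
      fix x assume x: "x \<in> c0 (v k) \<inter> U"
      then obtain r where r: "r > 0" "\<forall>y\<in>E. q (x - y) < r \<longrightarrow> y \<in> U"
        using N.openin_norm_topologyD[OF U] by (metis IntD2)
      have "M.mball x (r / (\<bar>D\<bar> + 1)) \<subseteq> c0 (v k) \<inter> U"
      proof
        fix y assume y: "y \<in> M.mball x (r / (\<bar>D\<bar> + 1))"
        then have "x - y \<in> c0 (v k)" using cseq.subspace_diff[OF c0_subspace] by auto
        then have "q (x - y) \<le> D * c0_norm (v k) (x - y)" by (rule D)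
        also have "\<dots> \<le> (\<bar>D\<bar> + 1) * c0_norm (v k) (x - y)"
          by (intro mult_right_mono) auto
        also have "\<dots> < r" using y by (simp add: field_simps)
        finally show "y \<in> c0 (v k) \<inter> U" using r(2) y step_subset by auto
      qed
      moreover have "r / (\<bar>D\<bar> + 1) > 0" using r(1) by simp
      ultimately show "\<exists>r>0. M.mball x r \<subseteq> c0 (v k) \<inter> U" by blast
    qed auto
    moreover have "{x \<in> topspace (c0_topology (v k)). x \<in> U} = c0 (v k) \<inter> U"
      by (auto simp: topspace_step)
    ultimately show "openin (c0_topology (v k)) {x \<in> topspace (c0_topology (v k)). x \<in> U}"
      by (simp add: c0_topology_def)
  qed
  then have "ind_compatible (\<lambda>k. c0_topology (v k)) N.norm_topology"
    unfolding ind_compatible_def N.topspace_norm_topology topspace_step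
    by (intro conjI allI N.lc_Hausdorff_norm_topology topspace_X)
  then show ?thesis using is_ind_lim_X U unfolding is_ind_lim_def by blast
qed

lemma cont_seminorm_if_norm:
  assumes "normed_cseq_space E q"
    and "\<And>k. \<exists>D. \<forall>x\<in>c0 (v k). q x \<le> D * c0_norm (v k) x"
  shows "cont_seminorm X q"
proof -
  interpret N: normed_cseq_space E q by (rule assms(1))
  have "openin X {x \<in> E. q x \<in> U}" if "openin euclidean U" for U
    using N.continuous_norm that unfolding continuous_map_def N.topspace_norm_topology
    by (intro openin_X_if_openin_norm[OF assms]) blast
  then have "continuous_map X euclideanreal q"
    unfolding continuous_map_def by simp
  then show ?thesis
    unfolding cont_seminorm_def using N.nonneg N.triangle N.scale by blast
qed

section \<open>Weighted summation norms\<close>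

text \<open>
  The positive elements of the Koethe dual of \<open>E\<close>. Strict positivity makes \<open>l1_norm a\<close> a norm rather
  than a seminorm, so that its topology is Hausdorff.
\<close>

definition dual_weights :: "(nat \<Rightarrow> real) set" where
  "dual_weights = {a. (\<forall>n. 0 < a n) \<and> (\<forall>k. summable (\<lambda>n. a n * growth k n))}"

definition l1_norm :: "(nat \<Rightarrow> real) \<Rightarrow> cseq \<Rightarrow> real" where
  "l1_norm a x = (\<Sum>n. a n * cmod (x n))"

lemma dual_weights_pos: "a \<in> dual_weights \<Longrightarrow> 0 < a n"
  by (simp add: dual_weights_def)

lemma l1_terms_bound:
  assumes a: "a \<in> dual_weights" and x: "x \<in> c0 (v k)"
  shows "a n * cmod (x n) \<le> c0_norm (v k) x * (a n * growth k n)"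
  using mult_left_mono[OF step_bound[OF x, of n], of "a n"] dual_weights_pos[OF a, of n]
  by (simp add: mult_ac)

lemma summable_l1:
  assumes a: "a \<in> dual_weights" and x: "x \<in> E"
  shows "summable (\<lambda>n. a n * cmod (x n))"
proof -
  obtain k where k: "x \<in> c0 (v k)" using x by (auto simp: mem_X_iff)
  have "summable (\<lambda>n. c0_norm (v k) x * (a n * growth k n))"
    using a by (intro summable_mult) (simp add: dual_weights_def)
  then show ?thesis
  proof (rule summable_comparison_test')
    show "norm (a n * cmod (x n)) \<le> c0_norm (v k) x * (a n * growth k n)" for n
      using l1_terms_bound[OF a k, of n] dual_weights_pos[OF a, of n] by (simp add: abs_mult)
  qed
qed

lemma l1_norm_step_bound:
  assumes a: "a \<in> dual_weights" and x: "x \<in> c0 (v k)"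
  shows "l1_norm a x \<le> (\<Sum>n. a n * growth k n) * c0_norm (v k) x"
proof -
  have sm: "summable (\<lambda>n. a n * growth k n)" using a by (simp add: dual_weights_def)
  have "l1_norm a x \<le> (\<Sum>n. c0_norm (v k) x * (a n * growth k n))"
    unfolding l1_norm_def using step_subset x
    by (intro suminf_le summable_l1[OF a] summable_mult sm l1_terms_bound[OF a x]) auto
  also have "\<dots> = (\<Sum>n. a n * growth k n) * c0_norm (v k) x"
    using suminf_mult[OF sm, of "c0_norm (v k) x"] by (simp add: mult.commute)
  finally show ?thesis .
qed

lemma normed_cseq_space_l1:
  assumes a: "a \<in> dual_weights"
  shows "normed_cseq_space E (l1_norm a)"
proof
  show "cseq.subspace E" by (rule subspace_X)
next
  fix x assume x: "x \<in> E"
  show "0 \<le> l1_norm a x"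
    unfolding l1_norm_def using dual_weights_pos[OF a]
    by (intro suminf_nonneg summable_l1[OF a x]) (simp add: less_imp_le)
  show "l1_norm a (c *\<^sub>C x) = cmod c * l1_norm a x" for c
    unfolding l1_norm_def using suminf_mult[OF summable_l1[OF a x], of "cmod c"]
    by (simp add: cscale_def norm_mult mult_ac)
  show "x = 0" if "l1_norm a x = 0"
  proof
    fix n
    have "\<forall>n. a n * cmod (x n) = 0"
      using that dual_weights_pos[OF a] unfolding l1_norm_def
      by (subst (asm) suminf_eq_zero_iff[OF summable_l1[OF a x]]) (auto simp: less_imp_le)
    then show "x n = 0 n" using dual_weights_pos[OF a, of n] by (auto dest: spec[of _ n])
  qed
next
  fix x y assume x: "x \<in> E" and y: "y \<in> E"
  have "l1_norm a (x + y) \<le> (\<Sum>n. a n * cmod (x n) + a n * cmod (y n))"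
    unfolding l1_norm_def
  proof (intro suminf_le summable_add summable_l1[OF a] x y cseq.subspace_add[OF subspace_X])
    show "a n * cmod ((x + y) n) \<le> a n * cmod (x n) + a n * cmod (y n)" for n
      using mult_left_mono[OF norm_triangle_ineq[of "x n" "y n"], of "a n"] dual_weights_pos[OF a, of n]
      by (simp add: distrib_left)
  qed
  then show "l1_norm a (x + y) \<le> l1_norm a x + l1_norm a y"
    unfolding l1_norm_def by (simp add: suminf_add summable_l1[OF a] x y)
qed

lemma openin_l1_ball:
  assumes a: "a \<in> dual_weights" and x: "x \<in> E"
  shows "openin X {y \<in> E. l1_norm a (x - y) < r}"
proof (rule openin_X_if_openin_norm)
  show "normed_cseq_space E (l1_norm a)" by (rule normed_cseq_space_l1[OF a])
  then show "openin (normed_cseq_space.norm_topology E (l1_norm a)) {y \<in> E. l1_norm a (x - y) < r}"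
    using x by (rule normed_cseq_space.openin_norm_ball)
qed (use l1_norm_step_bound[OF a] in blast)

text \<open>
  The weight \<open>2\<^sup>-\<^sup>n exp (- \<alpha>\<^sub>n\<^sup>2)\<close> works, since \<open>t ln s\<^sub>k - t\<^sup>2\<close> is bounded above in \<open>t > 0\<close>. It serves to make
  other weights strictly positive.
\<close>

lemma dual_weights_nonempty:
  obtains d where "d \<in> dual_weights"
proof
  define d where "d n = (1/2) ^ n * exp (- (\<alpha> n)\<^sup>2)" for n
  have "summable (\<lambda>n. d n * growth k n)" for k
  proof (rule summable_comparison_test'[where N = 0])
    let ?c = "ln (s k)"
    show "summable (\<lambda>n. exp (?c\<^sup>2) * (1/2::real) ^ n)" by (intro summable_mult summable_geometric) simp
    fix n
    \<comment> \<open>equivalent to \<open>\<alpha>\<^sub>n ln s\<^sub>k - \<alpha>\<^sub>n\<^sup>2 \<le> (ln s\<^sub>k)\<^sup>2\<close>\<close>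
    have "0 \<le> (?c - \<alpha> n)\<^sup>2 + ?c * \<alpha> n" using s_gt_1[of k] alpha_pos[of n] by simp
    then have "\<alpha> n * ?c - (\<alpha> n)\<^sup>2 \<le> ?c\<^sup>2" by (simp add: power2_eq_square algebra_simps)
    then have "exp (- (\<alpha> n)\<^sup>2) * growth k n \<le> exp (?c\<^sup>2)"
      using s_gt_1[of k] by (simp add: growth_def powr_def flip: exp_add)
    then show "norm (d n * growth k n) \<le> exp (?c\<^sup>2) * (1/2) ^ n"
      using growth_pos[of k n] by (simp add: d_def abs_mult mult_ac)
  qed
  then show "d \<in> dual_weights" by (simp add: dual_weights_def d_def)
qed

end

section \<open>Finitely supported sequences and weighted sup norms\<close>

text \<open>
  The hypothesis \<open>0 \<in> V\<close> takes up the slack when the coefficients add up to less than 1.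
\<close>

lemma cseq_convex_sum:
  fixes N :: nat
  assumes V: "cseq_convex V" "0 \<in> V"
  shows "(\<And>n. n < N \<Longrightarrow> z n \<in> V) \<Longrightarrow> (\<And>n. n < N \<Longrightarrow> 0 \<le> t n) \<Longrightarrow> (\<Sum>n<N. t n) \<le> 1 \<Longrightarrow>
    (\<Sum>n<N. of_real (t n) *\<^sub>C z n) \<in> V"
proof (induction N arbitrary: t)
  case 0
  show ?case using V(2) by (simp only: lessThan_0 sum.empty)
next
  case (Suc N)
  define \<tau> where "\<tau> = t N"
  have t0: "0 \<le> t n" if "n < N" for n using Suc.prems(2) that by simp
  have \<tau>: "0 \<le> \<tau>" "\<tau> \<le> 1" "(\<Sum>n<N. t n) \<le> 1 - \<tau>"
    using Suc.prems(2)[of N] Suc.prems(3) sum_nonneg[of "{..<N}" t] t0 by (auto simp: \<tau>_def)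
  have conv: "of_real (1 - \<tau>) *\<^sub>C x + of_real \<tau> *\<^sub>C z N \<in> V" if "x \<in> V" for x
    using V(1) that Suc.prems(1)[of N] \<tau> unfolding cseq_convex_def by blast
  \<comment> \<open>If \<open>\<tau> = 1\<close>, the other coefficients are 0 and so are the quotients by \<open>1 - \<tau>\<close>.\<close>
  have "(\<Sum>n<N. of_real (t n / (1 - \<tau>)) *\<^sub>C z n) \<in> V"
  proof (rule Suc.IH)
    show "(\<Sum>n<N. t n / (1 - \<tau>)) \<le> 1"
      using \<tau> by (cases "\<tau> = 1") (simp_all flip: sum_divide_distrib)
  qed (use Suc.prems(1) t0 \<tau> in auto)
  note conv = conv[OF this]
  have "of_real (1 - \<tau>) *\<^sub>C (\<Sum>n<N. of_real (t n / (1 - \<tau>)) *\<^sub>C z n) = (\<Sum>n<N. of_real (t n) *\<^sub>C z n)"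
    unfolding cseq.scale_sum_right
  proof (intro sum.cong refl)
    fix n assume n: "n \<in> {..<N}"
    have "t n \<le> (\<Sum>n<N. t n)" using n t0 by (intro member_le_sum) auto
    then have "(1 - \<tau>) * (t n / (1 - \<tau>)) = t n"
      using t0[of n] \<tau> n by (cases "\<tau> = 1") auto
    then show "of_real (1 - \<tau>) *\<^sub>C of_real (t n / (1 - \<tau>)) *\<^sub>C z n = of_real (t n) *\<^sub>C z n"
      unfolding cseq.scale_scale of_real_mult[symmetric] by simp
  qed
  with conv show ?case by (simp only: sum.lessThan_Suc \<tau>_def)
qed

definition unit_seq :: "nat \<Rightarrow> cseq" where
  "unit_seq n = (\<lambda>i. if i = n then 1 else 0)"

definition truncate :: "nat \<Rightarrow> cseq \<Rightarrow> cseq" where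
  "truncate N x = (\<lambda>i. if i < N then x i else 0)"

lemma truncate_0: "truncate 0 x = 0"
  by (simp add: truncate_def fun_eq_iff)

lemma truncate_Suc: "truncate (Suc N) x = truncate N x + x N *\<^sub>C unit_seq N"
  by (auto simp: truncate_def unit_seq_def cscale_def fun_eq_iff less_Suc_eq)

lemma truncate_mem_c0: "truncate N x \<in> c0 w"
proof -
  have "\<forall>\<^sub>F n in sequentially. w n * cmod (truncate N x n) = 0"
    using eventually_ge_at_top[of N] by eventually_elim (simp add: truncate_def)
  then show ?thesis unfolding c0_def mem_Collect_eq by (rule tendsto_eventually)
qed

lemma unit_seq_mem_c0: "unit_seq n \<in> c0 w"
proof -
  have "unit_seq n = truncate (Suc n) (unit_seq n)"
    by (auto simp: truncate_def unit_seq_def)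
  then show ?thesis using truncate_mem_c0 by metis
qed

lemma sum_seq_apply: "(\<Sum>j\<in>A. h j) n = (\<Sum>j\<in>A. h j n)" for h :: "'b \<Rightarrow> cseq"
  by (induction A rule: infinite_finite_induct) auto

lemma c0_norm_scale_le:
  assumes x: "x \<in> c0 w" shows "c0_norm w (c *\<^sub>C x) \<le> cmod c * c0_norm w x"
proof (rule c0_norm_least)
  show "c *\<^sub>C x \<in> c0 w" by (rule cseq.subspace_scale[OF c0_subspace x])
  show "w n * cmod ((c *\<^sub>C x) n) \<le> cmod c * c0_norm w x" for n
    using mult_left_mono[OF c0_norm_bound[OF x, of n] norm_ge_zero[of c]]
    by (simp add: cscale_def norm_mult mult_ac)
qed

context coechelon
begin

lemma
  assumes w: "\<And>n. 0 < w n" and D: "\<And>n. w n * growth k n \<le> D" and x: "x \<in> c0 (v k)"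
  shows step_mem_c0: "x \<in> c0 w"
    and c0_norm_le_step: "c0_norm w x \<le> D * c0_norm (v k) x"
proof -
  have le: "w n * cmod (x n) \<le> D * (v k n * cmod (x n))" for n
    using mult_right_mono[OF D[of n], of "v k n * cmod (x n)"] v_pos[of k n] growth_pos[of k n]
    by (simp add: v_eq)
  have "(\<lambda>n. D * (v k n * cmod (x n))) \<longlonglongrightarrow> 0"
    using x unfolding c0_def mem_Collect_eq by (rule tendsto_mult_right_zero)
  then show mem: "x \<in> c0 w"
    unfolding c0_def mem_Collect_eq
    by (rule Lim_null_comparison[OF always_eventually[OF allI], rotated])
       (use le w in \<open>simp add: abs_mult less_imp_le\<close>)
  have "0 \<le> D" using D[of 0] w[of 0] growth_pos[of k 0] by (meson mult_pos_pos less_le_trans less_imp_le)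
  then show "c0_norm w x \<le> D * c0_norm (v k) x"
    using le mult_left_mono[OF c0_norm_bound[OF x]] by (intro c0_norm_least[OF mem]) (meson order_trans)
qed

text \<open>
  A weight dominated by every \<open>v\<^sub>k\<close> gives a continuous norm on all of \<open>E\<close>. These norms are the ones to
  which nuclearity will be applied.
\<close>

lemma
  assumes w: "\<And>n. 0 < w n" and D: "\<And>k. \<exists>D. \<forall>n. w n * growth k n \<le> D"
  shows X_subset_c0: "E \<subseteq> c0 w"
    and cont_seminorm_c0_norm: "cont_seminorm X (c0_norm w)"
proof -
  show sub: "E \<subseteq> c0 w"
    using step_mem_c0[where w = w, OF w] D unfolding topspace_X by blast
  show "cont_seminorm X (c0_norm w)"
  proof (rule cont_seminorm_if_norm)
    show "\<exists>D. \<forall>x\<in>c0 (v k). c0_norm w x \<le> D * c0_norm (v k) x" for k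
      using c0_norm_le_step[where w = w, OF w] D[of k] by blast
    interpret M: Metric_space "c0 w" "\<lambda>x y. c0_norm w (x - y)"
      by (rule c0_Metric_space) (rule w)
    show "normed_cseq_space E (c0_norm w)"
    proof
      show "cseq.subspace E" by (rule subspace_X)
      fix x assume "x \<in> E"
      then have x: "x \<in> c0 w" using sub by blast
      have 0: "0 \<in> c0 w" by (rule cseq.subspace_0[OF c0_subspace])
      show "0 \<le> c0_norm w x" by (rule c0_norm_nonneg) (rule w)
      show "x = 0" if "c0_norm w x = 0" using M.zero[OF x 0] that by simp
      show "c0_norm w (c *\<^sub>C x) = cmod c * c0_norm w x" for c
      proof (rule antisym)
        show "c0_norm w (c *\<^sub>C x) \<le> cmod c * c0_norm w x" by (rule c0_norm_scale_le[OF x])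
        have c: "c *\<^sub>C x \<in> c0 w" by (rule cseq.subspace_scale[OF c0_subspace x])
        show "cmod c * c0_norm w x \<le> c0_norm w (c *\<^sub>C x)"
        proof (cases "c = 0")
          case True
          then show ?thesis using c0_norm_nonneg[where w = w, OF w] by simp
        next
          case False
          then show ?thesis
            using c0_norm_scale_le[OF c, of "1 / c"] by (simp add: norm_divide field_simps)
        qed
      qed
      fix y assume "y \<in> E"
      then have y: "y \<in> c0 w" using sub by blast
      show "c0_norm w (x + y) \<le> c0_norm w x + c0_norm w y"
        using M.triangle[OF x 0 cseq.subspace_neg[OF c0_subspace y]] M.commute[of 0 "-y"] by simp
    qed
  qed
qed

text \<open>
  Elements of the first step that are bounded by 1 lie in its closed unit ball because its weight is at
  most 1. The bound does not depend on the support of the sequence, and it is the only continuity property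
  of the larger seminorm that the trace argument uses.
\<close>

lemma cont_seminorm_bounded_on_cube:
  assumes q: "cont_seminorm X q"
  obtains D where "\<And>x. x \<in> c0 (v 0) \<Longrightarrow> (\<And>n. cmod (x n) \<le> 1) \<Longrightarrow> q x \<le> D"
proof -
  have sc: "q (c *\<^sub>C x) = cmod c * q x" if "x \<in> E" for c x
    using q that unfolding cont_seminorm_def by blast
  define S where "S = {x \<in> E. q x \<in> {..<1}}"
  have "openin X S"
    unfolding S_def
    by (rule openin_continuous_map_preimage[where Y = euclideanreal]) (use q in \<open>auto simp: cont_seminorm_def\<close>)
  moreover have "0 \<in> S"
    using sc[of 0 0] cseq.subspace_0[OF subspace_X] by (simp add: S_def)
  ultimately obtain \<delta> where d: "0 < \<delta>" "\<And>x. x \<in> c0 (v 0) \<Longrightarrow> c0_norm (v 0) x < \<delta> \<Longrightarrow> x \<in> S"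
    using openin_step[of S 0] by blast
  show thesis
  proof (rule that)
    fix x assume x: "x \<in> c0 (v 0)" and le: "\<And>n. cmod (x n) \<le> 1"
    have "c0_norm (v 0) x \<le> 1"
    proof (rule c0_norm_least[OF x])
      show "v 0 n * cmod (x n) \<le> 1" for n
        using le[of n] growth_ge_1[of 0 n] growth_pos[of 0 n] by (simp add: v_eq divide_le_eq)
    qed
    then have "\<delta> / 2 * c0_norm (v 0) x \<le> \<delta> / 2 * 1" using d(1) by (intro mult_left_mono) auto
    moreover have "c0_norm (v 0) (of_real (\<delta> / 2) *\<^sub>C x) \<le> \<delta> / 2 * c0_norm (v 0) x"
      using c0_norm_scale_le[OF x, of "of_real (\<delta> / 2)"] d(1)
      by (simp only: norm_of_real abs_of_pos half_gt_zero)
    ultimately have "c0_norm (v 0) (of_real (\<delta> / 2) *\<^sub>C x) \<le> \<delta> / 2" by linarith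
    then have "of_real (\<delta> / 2) *\<^sub>C x \<in> S"
      using d(1) by (intro d(2) cseq.subspace_scale[OF c0_subspace x]) simp
    then have "\<delta> / 2 * q x < 1"
      using sc[of x "of_real (\<delta> / 2)"] x step_subset[of 0] d(1) by (auto simp: S_def norm_divide)
    then show "q x \<le> 2 / \<delta>" using d(1) by (simp add: field_simps)
  qed
qed

lemma linear_functional_truncate:
  assumes add: "\<And>x y. x \<in> E \<Longrightarrow> y \<in> E \<Longrightarrow> f (x + y) = f x + (f y :: complex)"
    and scale: "\<And>c x. x \<in> E \<Longrightarrow> f (c *\<^sub>C x) = c * f x"
  shows "f (truncate N x) = (\<Sum>n<N. x n * f (unit_seq n))"
proof (induction N)
  case 0
  have "f 0 = 0" using scale[of 0 0] cseq.subspace_0[OF subspace_X] by simp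
  then show ?case by (simp only: truncate_0 lessThan_0 sum.empty)
next
  case (Suc N)
  have "truncate N x \<in> E" "unit_seq N \<in> E"
    using step_subset[of 0] truncate_mem_c0 unit_seq_mem_c0 by blast+
  then have "f (truncate N x + x N *\<^sub>C unit_seq N) = f (truncate N x) + x N * f (unit_seq N)"
    by (simp only: add scale cseq.subspace_scale[OF subspace_X])
  then show ?case by (simp only: truncate_Suc Suc sum.lessThan_Suc)
qed

section \<open>What nuclearity says about the exponents\<close>

text \<open>
  Let \<open>x = \<Sum>j. f\<^sub>j(x) y\<^sub>j\<close> be the nuclear series in the norm \<open>sup\<^sub>n w\<^sub>n \<bar>x\<^sub>n\<bar>\<close>, and let \<open>e\<^sub>n\<close> be the unit
  sequences. Reading off coordinate \<open>n\<close> of \<open>e\<^sub>n\<close> gives \<open>1 = \<Sum>j. f\<^sub>j(e\<^sub>n) y\<^sub>j(n)\<close>, hence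
  \<open>\<Sum>n<M. w\<^sub>n = \<Sum>j. \<Sum>n<M. f\<^sub>j(e\<^sub>n) w\<^sub>n y\<^sub>j(n)\<close>. In the inner sum \<open>w\<^sub>n \<bar>y\<^sub>j(n)\<bar>\<close> is at most the norm of \<open>y\<^sub>j\<close>, and
  \<open>\<Sum>n<M. \<bar>f\<^sub>j(e\<^sub>n)\<bar>\<close> is the value of \<open>f\<^sub>j\<close> at a sequence of signs, thus at most \<open>Q C\<^sub>j\<close>. What remains is
  the convergent series \<open>\<Sum>j. C\<^sub>j \<parallel>y\<^sub>j\<parallel>\<close>.
\<close>

lemma nuclear_imp_weights_summable:
  assumes nuc: "nuclear_space X"
    and w: "\<And>n. 0 < w n" and D: "\<And>k. \<exists>D. \<forall>n. w n * growth k n \<le> D"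
  obtains W where "\<And>M. (\<Sum>n<M. w n) \<le> W"
proof -
  have sub: "E \<subseteq> c0 w" by (rule X_subset_c0[where w = w, OF w D])
  obtain q where q: "cont_seminorm X q" and nq: "nuclear_canonical_map X q (c0_norm w)"
    using nuc cont_seminorm_c0_norm[where w = w, OF w D] unfolding nuclear_space_def by blast
  obtain f C y where H:
    "(\<forall>j. \<forall>u\<in>E. \<forall>v\<in>E. f j (u + v) = f j u + f j v) \<and>
     (\<forall>j. \<forall>c. \<forall>u\<in>E. f j (c *\<^sub>C u) = c * f j u) \<and>
     (\<forall>j. 0 \<le> C j \<and> (\<forall>u\<in>E. cmod (f j u) \<le> C j * q u)) \<and>
     (\<forall>j. y j \<in> E) \<and>
     summable (\<lambda>j. C j * c0_norm w (y j)) \<and>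
     (\<forall>u\<in>E. (\<lambda>N. c0_norm w (u - (\<Sum>j<N. f j u *\<^sub>C y j))) \<longlonglongrightarrow> 0)"
    using nq unfolding nuclear_canonical_map_def by (elim exE) (rule that)
  have add: "f j (u + u') = f j u + f j u'" if "u \<in> E" "u' \<in> E" for j u u'
    using H that by blast
  have scale: "f j (c *\<^sub>C u) = c * f j u" if "u \<in> E" for j c u
    using H that by blast
  have C: "0 \<le> C j" "u \<in> E \<Longrightarrow> cmod (f j u) \<le> C j * q u" for j u
    using H by blast+
  have y: "y j \<in> E" for j using H by blast
  have sm: "summable (\<lambda>j. C j * c0_norm w (y j))" using H by blast
  have lim: "(\<lambda>N. c0_norm w (u - (\<Sum>j<N. f j u *\<^sub>C y j))) \<longlonglongrightarrow> 0" if "u \<in> E" for u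
    using H that by blast
  obtain Q where Q: "\<And>x. x \<in> c0 (v 0) \<Longrightarrow> (\<And>n. cmod (x n) \<le> 1) \<Longrightarrow> q x \<le> Q"
    by (rule cont_seminorm_bounded_on_cube[OF q]) metis
  have Q0: "0 \<le> Q"
    using Q[of 0] cseq.subspace_0[OF c0_subspace] cseq.subspace_0[OF subspace_X] q
    unfolding cont_seminorm_def by (metis norm_zero order_trans zero_fun_apply zero_le_one)
  have e: "unit_seq n \<in> E" for n using step_subset[of 0] unit_seq_mem_c0 by blast
  have dual: "(\<Sum>n<M. cmod (f j (unit_seq n))) \<le> C j * Q" for j M
  proof -
    \<comment> \<open>unimodular factors (or 0) that turn every \<open>f\<^sub>j(e\<^sub>n)\<close> into its modulus\<close>
    define c where "c n = cnj (sgn (f j (unit_seq n)))" for n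
    have c1: "cmod (c n) \<le> 1" for n by (simp add: c_def norm_sgn)
    have cf: "c n * f j (unit_seq n) = of_real (cmod (f j (unit_seq n)))" for n
      unfolding c_def sgn_eq
      by (cases "f j (unit_seq n) = 0")
         (simp_all add: complex_norm_square[symmetric] mult.commute[of "cnj _"] power2_eq_square)
    have t: "truncate M c \<in> c0 (v 0)" by (rule truncate_mem_c0)
    have "f j (truncate M c) = of_real (\<Sum>n<M. cmod (f j (unit_seq n)))"
      using linear_functional_truncate[of "f j", OF add scale] cf by simp
    then have "(\<Sum>n<M. cmod (f j (unit_seq n))) = cmod (f j (truncate M c))"
      by (simp add: sum_nonneg del: of_real_sum)
    also have "\<dots> \<le> C j * q (truncate M c)" using t step_subset by (intro C) blast
    also have "\<dots> \<le> C j * Q"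
      using c1 by (intro mult_left_mono C(1) Q t) (simp add: truncate_def)
    finally show ?thesis .
  qed
  define W where "W = Q * (\<Sum>j. C j * c0_norm w (y j))"
  have "(\<Sum>n<M. w n) \<le> W" for M
  proof -
    define T where "T N = (\<Sum>n<M. of_real (w n) * (\<Sum>j<N. f j (unit_seq n) * y j n))" for N
    have "(\<lambda>N. (\<Sum>j<N. f j (unit_seq n) * y j n)) \<longlonglongrightarrow> 1" for n
    proof (rule Lim_transform2[OF tendsto_const])
      let ?r = "\<lambda>N. unit_seq n - (\<Sum>j<N. f j (unit_seq n) *\<^sub>C y j)"
      have "(\<lambda>N. c0_norm w (?r N) / w n) \<longlonglongrightarrow> 0"
        using tendsto_divide[OF lim[OF e[of n]] tendsto_const[of "w n"]] w[of n] by simp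
      then show "(\<lambda>N. 1 - (\<Sum>j<N. f j (unit_seq n) * y j n)) \<longlonglongrightarrow> 0"
      proof (rule Lim_null_comparison[OF always_eventually[OF allI], rotated])
        fix N
        have "?r N \<in> E"
          by (intro cseq.subspace_diff cseq.subspace_sum cseq.subspace_scale subspace_X e y)
        then have "w n * cmod (?r N n) \<le> c0_norm w (?r N)" using sub by (intro c0_norm_bound) blast
        moreover have "?r N n = 1 - (\<Sum>j<N. f j (unit_seq n) * y j n)"
          by (simp add: sum_seq_apply unit_seq_def cscale_def)
        ultimately have "w n * cmod (1 - (\<Sum>j<N. f j (unit_seq n) * y j n)) \<le> c0_norm w (?r N)"
          by (simp only:)
        then show "norm (1 - (\<Sum>j<N. f j (unit_seq n) * y j n)) \<le> c0_norm w (?r N) / w n"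
          unfolding pos_le_divide_eq[OF w] by (simp only: mult.commute)
      qed
    qed
    then have "T \<longlonglongrightarrow> (\<Sum>n<M. of_real (w n) * 1)"
      unfolding T_def by (intro tendsto_sum tendsto_mult tendsto_const)
    then have lim: "(\<lambda>N. cmod (T N)) \<longlonglongrightarrow> cmod (\<Sum>n<M. of_real (w n) * 1)"
      by (rule tendsto_norm)
    have "cmod (T N) \<le> W" for N
    proof -
      have "T N = (\<Sum>j<N. \<Sum>n<M. f j (unit_seq n) * (of_real (w n) * y j n))"
        unfolding T_def sum_distrib_left by (subst sum.swap) (simp add: mult_ac)
      also have "cmod \<dots> \<le> (\<Sum>j<N. \<Sum>n<M. cmod (f j (unit_seq n)) * c0_norm w (y j))"
      proof (intro sum_norm_le)
        fix j n
        have "w n * cmod (y j n) \<le> c0_norm w (y j)"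
          using sub y[of j] by (intro c0_norm_bound) blast
        then show "cmod (f j (unit_seq n) * (of_real (w n) * y j n)) \<le> cmod (f j (unit_seq n)) * c0_norm w (y j)"
          using w[of n] by (simp add: norm_mult mult_left_mono)
      qed
      also have "\<dots> = (\<Sum>j<N. (\<Sum>n<M. cmod (f j (unit_seq n))) * c0_norm w (y j))"
        by (simp add: sum_distrib_right)
      also have "\<dots> \<le> (\<Sum>j<N. C j * Q * c0_norm w (y j))"
        by (intro sum_mono mult_right_mono dual c0_norm_nonneg w)
      also have "\<dots> = Q * (\<Sum>j<N. C j * c0_norm w (y j))"
        by (simp add: sum_distrib_left mult_ac)
      also have "\<dots> \<le> W"
        unfolding W_def
        by (intro mult_left_mono[OF _ Q0] sum_le_suminf[OF sm] ballI mult_nonneg_nonneg C c0_norm_nonneg w) auto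
      finally show ?thesis .
    qed
    then have "cmod (\<Sum>n<M. of_real (w n) * 1) \<le> W" using lim by (intro Lim_bounded[OF lim]) auto
    moreover have "(\<Sum>n<M. of_real (w n) * 1) = (of_real (\<Sum>n<M. w n) :: complex)" by simp
    ultimately show ?thesis by (metis abs_le_D1 norm_of_real)
  qed
  then show thesis by (rule that)
qed

end

locale nuclear_coechelon = coechelon +
  assumes nuclear: "nuclear_space X"
begin

text \<open>
  Suppose \<open>\<rho>\<^sub>n = ln (n + 1) / \<alpha>\<^sub>n\<close> is unbounded and let \<open>\<phi>\<close> be its running maximum. Since \<open>\<phi>\<close> tends to
  infinity, \<open>w\<^sub>n = exp (- \<phi>\<^sub>n \<alpha>\<^sub>n / 2)\<close> is dominated by every \<open>v\<^sub>k\<close>, so \<open>\<Sum>n. w\<^sub>n \<le> W\<close> for some \<open>W\<close>. At an index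
  \<open>m\<close> with \<open>\<phi>\<^sub>m = \<rho>\<^sub>m\<close>, however, \<open>w\<^sub>m\<close> is the inverse square root of \<open>m + 1\<close>; as \<open>w\<close> decreases, the
  first \<open>m + 1\<close> weights already sum up to at least the square root of \<open>m + 1\<close>. So \<open>m < W\<^sup>2\<close> at all these
  indices, which bounds \<open>\<rho>\<close> after all.
\<close>

lemma ln_Suc_le_alpha:
  obtains M where "0 < M" "\<And>n. ln (real (Suc n)) \<le> M * \<alpha> n"
proof -
  define \<rho> where "\<rho> n = ln (real (Suc n)) / \<alpha> n" for n
  have \<rho>_nonneg: "0 \<le> \<rho> n" for n
    using alpha_pos[of n] by (simp add: \<rho>_def)
  define \<phi> where "\<phi> n = Max (\<rho> ` {..n})" for n
  have \<phi>_ge: "\<rho> i \<le> \<phi> n" if "i \<le> n" for i n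
    using that by (auto simp: \<phi>_def intro: Max_ge)
  have \<phi>_mono: "\<phi> i \<le> \<phi> n" if "i \<le> n" for i n
    unfolding \<phi>_def using that by (intro Max_mono image_mono) auto
  have \<phi>_attained: "\<exists>m\<le>n. \<phi> n = \<rho> m" for n
  proof -
    have "Max (\<rho> ` {..n}) \<in> \<rho> ` {..n}" by (intro Max_in) auto
    then show ?thesis unfolding \<phi>_def by (metis atMost_iff imageE)
  qed
  have "\<exists>B. \<forall>n. \<rho> n \<le> B"
  proof (rule ccontr)
    assume unb: "\<nexists>B. \<forall>n. \<rho> n \<le> B"
    have large: "\<exists>N. \<forall>n\<ge>N. B \<le> \<phi> n" for B
    proof -
      obtain N where "B < \<rho> N" using unb by (meson not_le)
      then show ?thesis using \<phi>_ge by (meson less_imp_le order_trans)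
    qed
    define w where "w n = exp (- (\<phi> n * \<alpha> n / 2))" for n
    have bounded: "\<exists>D. \<forall>n. w n * growth k n \<le> D" for k
    proof -
      obtain N where N: "\<And>n. N \<le> n \<Longrightarrow> 2 * ln (s k) \<le> \<phi> n" using large by blast
      have wg: "w n * growth k n = exp (\<alpha> n * (ln (s k) - \<phi> n / 2))" for n
        using s_gt_1[of k] by (simp add: w_def growth_def powr_def algebra_simps flip: exp_add)
      have "w n * growth k n \<le> (\<Sum>i<N. w i * growth k i) + 1" for n
      proof (cases "n < N")
        case True
        then have "w n * growth k n \<le> (\<Sum>i<N. w i * growth k i)"
          using growth_pos by (intro member_le_sum) (auto simp: w_def less_imp_le)
        then show ?thesis by simp
      next
        case False
        then have "\<alpha> n * (ln (s k) - \<phi> n / 2) \<le> 0"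
          using N[of n] alpha_pos[of n] by (simp add: mult_le_0_iff)
        then have "w n * growth k n \<le> 1" unfolding wg by simp
        moreover have "0 \<le> (\<Sum>i<N. w i * growth k i)"
          using growth_pos by (intro sum_nonneg) (auto simp: w_def less_imp_le)
        ultimately show ?thesis by simp
      qed
      then show ?thesis by blast
    qed
    have w_pos: "0 < w n" for n by (simp add: w_def)
    obtain W where W: "\<And>M. (\<Sum>n<M. w n) \<le> W"
      using nuclear_imp_weights_summable[of w, OF nuclear w_pos bounded] by blast
    obtain N :: nat where N: "W\<^sup>2 < real N" using reals_Archimedean2 by blast
    have "\<rho> n \<le> (\<Sum>i<N. \<rho> i)" for n
    proof -
      obtain m where m: "m \<le> n" "\<phi> n = \<rho> m" using \<phi>_attained by blast
      have \<phi>m: "\<phi> m = \<rho> m" using \<phi>_ge[of m m] \<phi>_mono[OF m(1)] m(2) by simp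
      have "w m \<le> w i" if "i < Suc m" for i
      proof -
        have "\<alpha> i \<le> \<alpha> m" using that alpha_mono by (simp add: strict_mono_less_eq)
        then have "\<phi> i * \<alpha> i \<le> \<phi> m * \<alpha> m"
          using that \<phi>_mono[of i m] \<rho>_nonneg[of m] \<phi>m alpha_pos[of i] by (intro mult_mono) auto
        then show ?thesis by (simp add: w_def)
      qed
      then have "real (Suc m) * w m \<le> (\<Sum>i<Suc m. w i)"
        using sum_bounded_below[of "{..<Suc m}" "w m" w] by simp
      also have "\<dots> \<le> W" by (rule W)
      finally have le: "real (Suc m) * w m \<le> W" .
      have "w m = exp (- (ln (real (Suc m)) / 2))"
        unfolding w_def \<phi>m using alpha_pos[of m] by (simp add: \<rho>_def)
      then have "(w m)\<^sup>2 = exp (- ln (real (Suc m)))"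
        unfolding power2_eq_square by (simp flip: exp_add)
      then have "(w m)\<^sup>2 = 1 / real (Suc m)"
        by (simp add: exp_minus inverse_eq_divide)
      then have "(real (Suc m) * w m)\<^sup>2 = real (Suc m)"
        by (simp only: power_mult_distrib) (simp add: power2_eq_square[of "1 + real m"])
      moreover have "(real (Suc m) * w m)\<^sup>2 \<le> W\<^sup>2"
        using le w_pos[of m] by (intro power_mono) auto
      ultimately have "m < N" using N by linarith
      then have "\<rho> m \<le> (\<Sum>i<N. \<rho> i)" using \<rho>_nonneg by (intro member_le_sum) auto
      then show ?thesis using \<phi>_ge[of n n] m(2) by simp
    qed
    then show False using unb by blast
  qed
  then obtain B where B: "\<And>n. \<rho> n \<le> B" by blast
  show thesis
  proof (rule that)
    show "0 < \<bar>B\<bar> + 1" by simp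
    have "\<rho> n \<le> \<bar>B\<bar> + 1" for n using B[of n] by simp
    then show "ln (real (Suc n)) \<le> (\<bar>B\<bar> + 1) * \<alpha> n" for n
      using alpha_pos[of n] unfolding \<rho>_def by (metis pos_divide_le_eq)
  qed
qed

text \<open>
  The form in which nuclearity is used from now on. By the logarithmic bound
  \<open>(n + 1)\<^sup>K \<le> exp (K M)\<^bsup>\<alpha>\<^sub>n\<^esup>\<close>, so any \<open>l\<close> with \<open>s\<^sub>l \<ge> s\<^sub>k exp (K M)\<close> will do.
\<close>

lemma power_absorbed: "\<exists>l. \<forall>n. real (Suc n) ^ K * growth k n \<le> growth l n"
proof -
  obtain M where M: "0 < M" "\<And>n. ln (real (Suc n)) \<le> M * \<alpha> n" using ln_Suc_le_alpha by blast
  obtain l where l: "s k * exp (real K * M) \<le> s l"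
    using s_lim unfolding filterlim_at_top eventually_sequentially by (meson order_refl)
  have sk: "0 < s k" using s_gt_1[of k] by simp
  show ?thesis
  proof (intro exI allI)
    fix n
    have "real (Suc n) ^ K = exp (real K * ln (real (Suc n)))"
      by (simp add: exp_of_nat_mult)
    also have "\<dots> \<le> exp (real K * M * \<alpha> n)"
      using mult_left_mono[OF M(2)[of n], of "real K"] by (simp add: mult.assoc)
    also have "\<dots> = exp (real K * M) powr \<alpha> n" by (simp add: powr_def mult.commute)
    finally have "real (Suc n) ^ K * growth k n \<le> exp (real K * M) powr \<alpha> n * s k powr \<alpha> n"
      unfolding growth_def by (intro mult_right_mono) auto
    also have "\<dots> = (s k * exp (real K * M)) powr \<alpha> n"
      using sk by (simp add: powr_mult mult.commute)
    also have "\<dots> \<le> growth l n"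
      unfolding growth_def using l sk alpha_pos[of n] by (intro powr_mono2) auto
    finally show "real (Suc n) ^ K * growth k n \<le> growth l n" .
  qed
qed

section \<open>A neighbourhood base of zero\<close>

lemma summable_inverse_Suc_squared: "summable (\<lambda>n. c / (real (Suc n))\<^sup>2)"
proof -
  have "summable (\<lambda>n. inverse (real (Suc n) ^ 2))"
    using inverse_power_summable[of 2, where ?'a = real] by (subst summable_Suc_iff) simp
  then show ?thesis using summable_mult by (simp add: divide_inverse)
qed

text \<open>
  Boundedness against all growth rates already implies summability against all of them: pass to a
  growth rate that absorbs \<open>(n + 1)\<^sup>2\<close>.
\<close>

lemma dual_weightsI:
  assumes pos: "\<And>n. 0 < a n" and D: "\<And>k. \<exists>D. \<forall>n. a n * growth k n \<le> D"
  shows "a \<in> dual_weights"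
proof -
  have "summable (\<lambda>n. a n * growth k n)" for k
  proof -
    obtain l where l: "\<And>n. real (Suc n) ^ 2 * growth k n \<le> growth l n" using power_absorbed by blast
    obtain D where D: "\<And>n. a n * growth l n \<le> D" using D by blast
    show ?thesis
    proof (rule summable_comparison_test'[OF summable_inverse_Suc_squared])
      fix n
      have "(real (Suc n))\<^sup>2 * (a n * growth k n) \<le> D"
        using mult_left_mono[OF l[of n] less_imp_le[OF pos[of n]]] D[of n] by (simp add: mult_ac)
      then show "norm (a n * growth k n) \<le> D / (real (Suc n))\<^sup>2"
        using pos[of n] growth_pos[of k n] by (simp add: pos_le_divide_eq mult.commute abs_mult)
    qed
  qed
  then show ?thesis using pos by (simp add: dual_weights_def)
qed

lemma dual_weights_bounded:
  assumes a: "a \<in> dual_weights" shows "\<exists>D. \<forall>n. a n * growth k n \<le> D"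
proof -
  have "summable (\<lambda>n. a n * growth k n)" using a by (simp add: dual_weights_def)
  from summable_imp_bounded[OF this] show ?thesis
    unfolding bounded_iff by (auto simp: abs_le_iff)
qed

text \<open>
  Let the convex neighbourhood contain the ball of radius \<open>\<delta>\<^sub>k\<close> of each step. Multiples \<open>c e\<^sub>n\<close> of a unit
  sequence lie in it as soon as \<open>\<bar>c\<bar> < \<delta>\<^sub>k / v\<^sub>k(n)\<close> for one \<open>k\<close>, which suggests the weight
  \<open>h\<^sub>n = inf\<^sub>k v\<^sub>k(n) / \<delta>\<^sub>k\<close>. If \<open>\<Sum>n. a\<^sub>n \<bar>x\<^sub>n\<bar> < 1\<close>, a finite section of \<open>x\<close> is a convex combination of such
  multiples, while the tail of \<open>x\<close> is small in the step that contains \<open>x\<close>. The factor 2 in \<open>a\<close> leaves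
  half of the neighbourhood to each of the two parts.
\<close>

lemma nbhd_contains_l1_ball:
  assumes V: "openin X V" "0 \<in> V"
  obtains a where "a \<in> dual_weights" "\<And>x. x \<in> E \<Longrightarrow> l1_norm a x < 1 \<Longrightarrow> x \<in> V"
proof -
  obtain C where C: "openin X C" "0 \<in> C" "C \<subseteq> V" "cseq_convex C"
    using lc_Hausdorff_X V unfolding lc_Hausdorff_def by metis
  obtain \<delta> where d: "\<And>k. 0 < \<delta> k" "\<And>k x. x \<in> c0 (v k) \<Longrightarrow> c0_norm (v k) x < \<delta> k \<Longrightarrow> x \<in> C"
    using openin_step[OF C(1,2)] by metis
  obtain d where dw: "d \<in> dual_weights" by (rule dual_weights_nonempty)
  define h where "h n = (INF k. v k n / \<delta> k)" for n
  have bdd: "bdd_below (range (\<lambda>k. v k n / \<delta> k))" for n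
    using v_pos d(1) by (intro bdd_belowI[where m = 0]) (auto simp: less_imp_le)
  have h_le: "h n \<le> v k n / \<delta> k" for n k
    unfolding h_def by (rule cINF_lower[OF bdd]) simp
  have h0: "0 \<le> h n" for n
    unfolding h_def using v_pos d(1) by (intro cINF_greatest) (auto simp: less_imp_le)
  \<comment> \<open>The infimum \<open>h\<^sub>n\<close> may vanish and need not be attained; adding \<open>d\<^sub>n\<close> deals with both.\<close>
  define a where "a n = 2 * (h n + d n)" for n
  have a_pos: "0 < a n" for n using h0[of n] dual_weights_pos[OF dw, of n] by (simp add: a_def)
  have a: "a \<in> dual_weights"
  proof (rule dual_weightsI[OF a_pos])
    fix k
    obtain D where D: "\<And>n. d n * growth k n \<le> D" using dual_weights_bounded[OF dw] by blast
    define c where "c = 1 / \<delta> k"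
    have "a n * growth k n \<le> 2 * (c + D)" for n
    proof -
      have hn: "h n * growth k n \<le> c"
        unfolding c_def using mult_right_mono[OF h_le[of n k], of "growth k n"] growth_pos[of k n] by (simp add: v_eq)
      have "a n * growth k n = 2 * (h n * growth k n + d n * growth k n)"
        by (simp add: a_def algebra_simps)
      also have "\<dots> \<le> 2 * (c + D)" by (intro mult_left_mono add_mono hn D) simp
      finally show ?thesis .
    qed
    then show "\<exists>D. \<forall>n. a n * growth k n \<le> D" by blast
  qed
  have single: "c *\<^sub>C unit_seq n \<in> C" if c: "cmod c * a n \<le> 2" for c n
  proof (cases "c = 0")
    case True
    then show ?thesis using C(2) by simp
  next
    case False
    have "cmod c * h n < 1"
    proof -
      have "0 < cmod c * d n" using False dual_weights_pos[OF dw, of n] by simp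
      moreover have "cmod c * h n + cmod c * d n \<le> 1" using c by (simp add: a_def distrib_left)
      ultimately show ?thesis by simp
    qed
    then have "h n < 1 / cmod c" using False by (simp add: field_simps)
    then obtain k where "v k n / \<delta> k < 1 / cmod c"
      unfolding h_def using cInf_lessD[of "range (\<lambda>k. v k n / \<delta> k)"] by auto
    then have k: "cmod c * v k n < \<delta> k" using False d(1)[of k] by (simp add: field_simps)
    have mem: "c *\<^sub>C unit_seq n \<in> c0 (v k)"
      by (rule cseq.subspace_scale[OF c0_subspace unit_seq_mem_c0])
    have "c0_norm (v k) (c *\<^sub>C unit_seq n) \<le> cmod c * v k n"
      using v_pos[of k n] by (intro c0_norm_least[OF mem]) (auto simp: cscale_def unit_seq_def)
    then show ?thesis using d(2)[OF mem] k by simp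
  qed
  show thesis
  proof (rule that[OF a])
    fix x assume x: "x \<in> E" and small: "l1_norm a x < 1"
    have trunc: "2 *\<^sub>C truncate N x \<in> C" for N
    proof -
      define t where "t n = a n * cmod (x n)" for n
      \<comment> \<open>if \<open>x\<^sub>n = 0\<close>, division by \<open>t\<^sub>n = 0\<close> gives \<open>z\<^sub>n = 0\<close>, as it should\<close>
      define z where "z n = (2 * x n / of_real (t n)) *\<^sub>C unit_seq n" for n
      have t0: "0 \<le> t n" for n using a_pos[of n] by (simp add: t_def)
      have "(\<Sum>n<N. of_real (t n) *\<^sub>C z n) \<in> C"
      proof (rule cseq_convex_sum[OF C(4,2)])
        show "z n \<in> C" for n
          unfolding z_def using a_pos[of n]
          by (intro single) (simp add: t_def norm_mult norm_divide)
        have "(\<Sum>n<N. t n) \<le> l1_norm a x"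
          unfolding l1_norm_def t_def using a_pos
          by (intro sum_le_suminf summable_l1[OF a x]) (auto simp: less_imp_le)
        then show "(\<Sum>n<N. t n) \<le> 1" using small by simp
      qed (rule t0)
      moreover have "(\<Sum>n<N. of_real (t n) *\<^sub>C z n) = 2 *\<^sub>C truncate N x"
      proof
        fix i
        have "of_real (t n) * (2 * x n / of_real (t n)) = 2 * x n" for n
          using a_pos[of n] by (simp add: t_def)
        then have "(\<Sum>n<N. of_real (t n) *\<^sub>C z n) i = (\<Sum>n<N. 2 * (x n * unit_seq n i))"
          unfolding sum_seq_apply z_def cscale_def mult.assoc[symmetric] by simp
        also have "\<dots> = (2 *\<^sub>C truncate N x) i"
          by (simp add: unit_seq_def cscale_def truncate_def if_distrib[of "\<lambda>u. 2 * (x _ * u)"] cong: if_cong)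
        finally show "(\<Sum>n<N. of_real (t n) *\<^sub>C z n) i = (2 *\<^sub>C truncate N x) i" .
      qed
      ultimately show ?thesis by simp
    qed
    obtain k where k: "x \<in> c0 (v k)" using x by (auto simp: mem_X_iff)
    have "\<forall>\<^sub>F n in sequentially. v k n * cmod (x n) < \<delta> k / 4"
      using k d(1)[of k] unfolding c0_def mem_Collect_eq by (intro order_tendstoD(2)) auto
    then obtain N where N: "\<And>n. N \<le> n \<Longrightarrow> v k n * cmod (x n) < \<delta> k / 4"
      unfolding eventually_sequentially by blast
    define y where "y = 2 *\<^sub>C (x - truncate N x)"
    have y: "y \<in> c0 (v k)"
      unfolding y_def by (intro cseq.subspace_scale cseq.subspace_diff c0_subspace k truncate_mem_c0)
    have "c0_norm (v k) y \<le> \<delta> k / 2"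
    proof (rule c0_norm_least[OF y])
      show "v k n * cmod (y n) \<le> \<delta> k / 2" for n
        using N[of n] d(1)[of k] by (cases "n < N") (simp_all add: y_def cscale_def truncate_def norm_mult)
    qed
    then have yC: "y \<in> C" using d(1)[of k] by (intro d(2)[OF y]) simp
    have "of_real (1 - 1 / 2) *\<^sub>C 2 *\<^sub>C truncate N x + of_real (1 / 2) *\<^sub>C y \<in> C"
      by (rule C(4)[unfolded cseq_convex_def, rule_format, OF trunc[of N] yC]) simp
    moreover have "of_real (1 - 1 / 2) *\<^sub>C 2 *\<^sub>C truncate N x + of_real (1 / 2) *\<^sub>C y = x"
      by (simp add: fun_eq_iff y_def cscale_def diff_divide_distrib)
    ultimately show "x \<in> V" using C(3) by auto
  qed
qed

section \<open>Equicontinuity of polynomially bounded lower triangular maps\<close>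

text \<open>
  The linear maps on \<open>E\<close> whose \<open>n\<close>-th coordinate sees only the first coordinates of the argument, up to
  \<open>n\<close>, with coefficients bounded by \<open>B (n + 1)\<^sup>K\<close>. Only the values on \<open>E\<close> matter, since a resolvent is
  determined by its definition only there.
\<close>

definition poly_causal :: "real \<Rightarrow> nat \<Rightarrow> (cseq \<Rightarrow> cseq) set" where
  "poly_causal B K = {T. (\<forall>x\<in>E. \<forall>y\<in>E. T (x + y) = T x + T y) \<and>
     (\<forall>c. \<forall>x\<in>E. T (c *\<^sub>C x) = c *\<^sub>C T x) \<and>
     (\<forall>x\<in>E. \<forall>n. cmod (T x n) \<le> B * real (Suc n) ^ K * (\<Sum>i\<le>n. cmod (x i)))}"

lemma poly_causal_bound:
  "T \<in> poly_causal B K \<Longrightarrow> x \<in> E \<Longrightarrow> cmod (T x n) \<le> B * real (Suc n) ^ K * (\<Sum>i\<le>n. cmod (x i))"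
  by (simp add: poly_causal_def)

lemma poly_causal_add:
  "T \<in> poly_causal B K \<Longrightarrow> x \<in> E \<Longrightarrow> y \<in> E \<Longrightarrow> T (x + y) = T x + T y"
  by (simp add: poly_causal_def)

lemma growth_mono: "i \<le> n \<Longrightarrow> growth k i \<le> growth k n"
  using s_gt_1[of k] alpha_mono by (simp add: growth_def strict_mono_less_eq)

text \<open>
  The growth rate \<open>k\<close> alone gives a bounded, not a null sequence; absorbing one factor \<open>n + 1\<close> into a
  larger growth rate makes up for the difference.
\<close>

lemma mem_X_if_bound:
  assumes "\<And>n. cmod (x n) \<le> B * growth k n"
  shows "x \<in> E"
proof -
  obtain l where l: "\<And>n. real (Suc n) ^ 1 * growth k n \<le> growth l n" using power_absorbed by blast
  have "(\<lambda>n. B * (1 / real (Suc n))) \<longlonglongrightarrow> B * 0"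
    by (intro tendsto_mult tendsto_const LIMSEQ_inverse_real_of_nat[unfolded inverse_eq_divide])
  then have lim: "(\<lambda>n. B * (1 / real (Suc n))) \<longlonglongrightarrow> 0" by simp
  have "norm (v l n * cmod (x n)) \<le> B * (1 / real (Suc n))" for n
  proof -
    have "0 \<le> B * growth k n" using assms[of n] norm_ge_zero[of "x n"] by linarith
    then have B: "0 \<le> B" using growth_pos[of k n] by (simp add: zero_le_mult_iff)
    have "real (Suc n) * cmod (x n) \<le> B * (real (Suc n) * growth k n)"
      using mult_left_mono[OF assms[of n], of "real (Suc n)"] by (simp add: mult_ac)
    also have "\<dots> \<le> B * growth l n" using l[of n] by (intro mult_left_mono B) simp
    finally show ?thesis
      using growth_pos[of l n] by (simp add: v_eq field_simps)
  qed
  then have "x \<in> c0 (v l)"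
    unfolding c0_def mem_Collect_eq
    by (intro Lim_null_comparison[OF always_eventually[OF allI] lim])
  then show ?thesis by (auto simp: mem_X_iff)
qed

lemma poly_causal_maps:
  assumes T: "T \<in> poly_causal B K" and B: "0 \<le> B" and x: "x \<in> E"
  shows "T x \<in> E"
proof -
  obtain k where k: "x \<in> c0 (v k)" using x by (auto simp: mem_X_iff)
  let ?N = "c0_norm (v k) x"
  have N: "0 \<le> ?N" by (rule c0_norm_nonneg) (rule v_pos)
  obtain l where l: "\<And>n. real (Suc n) ^ Suc K * growth k n \<le> growth l n" using power_absorbed by blast
  show ?thesis
  proof (rule mem_X_if_bound)
    fix n
    have "(\<Sum>i\<le>n. cmod (x i)) \<le> (\<Sum>i\<le>n. ?N * growth k n)"
      using step_bound[OF k] by (intro sum_mono) (meson N atMost_iff growth_mono mult_left_mono order_trans)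
    then have "B * real (Suc n) ^ K * (\<Sum>i\<le>n. cmod (x i)) \<le> B * real (Suc n) ^ K * (real (Suc n) * (?N * growth k n))"
      using B by (intro mult_left_mono) auto
    also have "\<dots> = B * ?N * (real (Suc n) ^ Suc K * growth k n)" by (simp only: power_Suc mult_ac)
    also have "\<dots> \<le> B * ?N * growth l n" using l[of n] B N by (intro mult_left_mono) auto
    finally show "cmod (T x n) \<le> B * ?N * growth l n"
      by (rule order_trans[OF poly_causal_bound[OF T x]])
  qed
qed

text \<open>
  Put \<open>c\<^sub>n = B (n + 1)\<^sup>K a\<^sub>n\<close>. Interchanging the sums,
  \<open>\<Sum>n. a\<^sub>n \<bar>(T x)\<^sub>n\<bar> \<le> \<Sum>n. c\<^sub>n (\<Sum>i\<le>n. \<bar>x\<^sub>i\<bar>) = \<Sum>i. b\<^sub>i \<bar>x\<^sub>i\<bar>\<close> with the tails \<open>b\<^sub>i\<close> of the series of \<open>c\<close>. Both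
  steps stay within the dual weights: \<open>c\<close> because powers are absorbed, \<open>b\<close> because the growth rates are
  increasing, so that \<open>b\<^sub>i growth k i \<le> \<Sum>n. c\<^sub>n growth k n\<close>. The weight \<open>b\<close> depends on \<open>T\<close> only through \<open>B\<close>
  and \<open>K\<close>, which is the source of equicontinuity.
\<close>

lemma poly_causal_l1_bound:
  assumes B: "0 < B" and a: "a \<in> dual_weights"
  obtains b where "b \<in> dual_weights"
    "\<And>T x. T \<in> poly_causal B K \<Longrightarrow> x \<in> E \<Longrightarrow> l1_norm a (T x) \<le> l1_norm b x"
proof -
  define c where "c n = B * real (Suc n) ^ K * a n" for n
  have c_pos: "0 < c n" for n using B dual_weights_pos[OF a, of n] by (simp add: c_def)
  have c: "c \<in> dual_weights"
  proof (rule dual_weightsI[OF c_pos])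
    fix k
    obtain l where l: "\<And>n. real (Suc n) ^ K * growth k n \<le> growth l n" using power_absorbed by blast
    obtain D where D: "\<And>n. a n * growth l n \<le> D" using dual_weights_bounded[OF a] by blast
    have "c n * growth k n \<le> B * D" for n
    proof -
      have "c n * growth k n = B * (a n * (real (Suc n) ^ K * growth k n))" by (simp only: c_def mult_ac)
      also have "\<dots> \<le> B * (a n * growth l n)"
        using l[of n] B dual_weights_pos[OF a, of n] by (intro mult_left_mono) auto
      also have "\<dots> \<le> B * D" using D[of n] B by simp
      finally show ?thesis .
    qed
    then show "\<exists>D. \<forall>n. c n * growth k n \<le> D" by blast
  qed
  have cg: "summable (\<lambda>n. c n * growth k n)" for k using c by (simp add: dual_weights_def)
  have c_sum: "summable c"
  proof (rule summable_comparison_test'[OF cg[of 0]])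
    show "norm (c n) \<le> c n * growth 0 n" for n
      using mult_left_mono[OF growth_ge_1[of 0 n], of "c n"] c_pos[of n] by simp
  qed
  define b where "b i = (\<Sum>n. c (n + i))" for i
  have c_tail: "summable (\<lambda>n. c (n + i))" for i using c_sum by simp
  have b: "b \<in> dual_weights"
  proof (rule dual_weightsI)
    show "0 < b i" for i
      unfolding b_def by (rule suminf_pos[OF c_tail]) (rule c_pos)
    fix k
    have "b i * growth k i \<le> (\<Sum>n. c n * growth k n)" for i
    proof -
      have tail: "summable (\<lambda>n. c (n + i) * growth k (n + i))"
        using summable_ignore_initial_segment[OF cg[of k]] by blast
      have "b i * growth k i = (\<Sum>n. c (n + i) * growth k i)"
        unfolding b_def by (rule suminf_mult2[OF c_tail])
      also have "\<dots> \<le> (\<Sum>n. c (n + i) * growth k (n + i))"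
        using c_pos by (intro suminf_le tail summable_mult2 c_tail mult_left_mono growth_mono) (auto simp: less_imp_le)
      also have "\<dots> = (\<Sum>n. c n * growth k n) - (\<Sum>n<i. c n * growth k n)"
        by (rule suminf_minus_initial_segment[OF cg])
      also have "\<dots> \<le> (\<Sum>n. c n * growth k n)"
        using c_pos growth_pos by (simp add: sum_nonneg less_imp_le)
      finally show ?thesis .
    qed
    then show "\<exists>D. \<forall>i. b i * growth k i \<le> D" by blast
  qed
  show thesis
  proof (rule that[OF b])
    fix T x assume T: "T \<in> poly_causal B K" and x: "x \<in> E"
    have Tx: "T x \<in> E" by (rule poly_causal_maps[OF T less_imp_le[OF B] x])
    have "(\<Sum>n<N. a n * cmod (T x n)) \<le> l1_norm b x" for N
    proof -
      have "(\<Sum>n<N. a n * cmod (T x n)) \<le> (\<Sum>n<N. c n * (\<Sum>i\<le>n. cmod (x i)))"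
      proof (rule sum_mono)
        fix n
        have "cmod (T x n) \<le> B * real (Suc n) ^ K * (\<Sum>i\<le>n. cmod (x i))"
          by (rule poly_causal_bound[OF T x])
        from mult_left_mono[OF this, of "a n"] show "a n * cmod (T x n) \<le> c n * (\<Sum>i\<le>n. cmod (x i))"
          using dual_weights_pos[OF a, of n] by (simp add: c_def mult_ac)
      qed
      also have "\<dots> = (\<Sum>n<N. \<Sum>i\<in>{i. i < N \<and> i \<le> n}. c n * cmod (x i))"
        unfolding sum_distrib_left by (intro sum.cong refl) auto
      also have "\<dots> = (\<Sum>i<N. \<Sum>n\<in>{n. n < N \<and> i \<le> n}. c n * cmod (x i))"
        using sum.swap_restrict[of "{..<N}" "{..<N}" "\<lambda>n i. c n * cmod (x i)" "\<lambda>n i. i \<le> n"]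
        by (simp add: lessThan_def)
      also have "\<dots> \<le> (\<Sum>i<N. b i * cmod (x i))"
      proof (rule sum_mono)
        fix i
        have "(\<Sum>n\<in>{n. n < N \<and> i \<le> n}. c n) = (\<Sum>n<N - i. c (n + i))"
          by (rule sum.reindex_bij_witness[where i = "\<lambda>n. n + i" and j = "\<lambda>n. n - i"]) auto
        also have "\<dots> \<le> b i"
          unfolding b_def using c_pos by (intro sum_le_suminf c_tail) (auto simp: less_imp_le)
        finally show "(\<Sum>n\<in>{n. n < N \<and> i \<le> n}. c n * cmod (x i)) \<le> b i * cmod (x i)"
          unfolding sum_distrib_right[symmetric] by (intro mult_right_mono) auto
      qed
      also have "\<dots> \<le> l1_norm b x"
        unfolding l1_norm_def using dual_weights_pos[OF b]
        by (intro sum_le_suminf summable_l1[OF b x]) (auto simp: less_imp_le)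
      finally show ?thesis .
    qed
    then show "l1_norm a (T x) \<le> l1_norm b x"
      unfolding l1_norm_def[of a] by (rule suminf_le_const[OF summable_l1[OF a Tx]])
  qed
qed

lemma continuous_translation:
  assumes c: "c \<in> E" shows "continuous_map X X (\<lambda>z. z + c)"
proof -
  have "continuous_map X (prod_topology X X) (\<lambda>z. (z, c))"
    using c by (intro continuous_map_pairedI) auto
  moreover have "continuous_map (prod_topology X X) X (\<lambda>(x, y). x + y)"
    using lc_Hausdorff_X by (simp add: lc_Hausdorff_def)
  ultimately have "continuous_map X X ((\<lambda>(x, y). x + y) \<circ> (\<lambda>z. (z, c)))"
    by (rule continuous_map_compose)
  then show ?thesis by (simp add: o_def)
qed

lemma poly_causal_continuous:
  assumes T: "T \<in> poly_causal B K" and B: "0 < B"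
  shows "continuous_map X X T"
  unfolding continuous_map_def
proof (intro conjI allI impI)
  show "T \<in> E \<rightarrow> E" using poly_causal_maps[OF T less_imp_le[OF B]] by blast
  fix U assume U: "openin X U"
  show "openin X {x \<in> E. T x \<in> U}"
  proof (subst openin_subopen, rule ballI)
    fix x assume "x \<in> {x \<in> E. T x \<in> U}"
    then have x: "x \<in> E" "T x \<in> U" by auto
    have Tx: "T x \<in> E" using poly_causal_maps[OF T less_imp_le[OF B] x(1)] .
    define U' where "U' = {z \<in> E. z + T x \<in> U}"
    have "openin X U'"
      unfolding U'_def by (rule openin_continuous_map_preimage[OF continuous_translation[OF Tx] U])
    moreover have "0 \<in> U'" using x cseq.subspace_0[OF subspace_X] by (simp add: U'_def)
    ultimately obtain a where a: "a \<in> dual_weights" "\<And>z. z \<in> E \<Longrightarrow> l1_norm a z < 1 \<Longrightarrow> z \<in> U'"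
      using nbhd_contains_l1_ball by blast
    obtain b where b: "b \<in> dual_weights" "\<And>z. z \<in> E \<Longrightarrow> l1_norm a (T z) \<le> l1_norm b z"
      using poly_causal_l1_bound[OF B a(1)] T by metis
    define W where "W = {y \<in> E. l1_norm b (x - y) < 1}"
    interpret b: normed_cseq_space E "l1_norm b" by (rule normed_cseq_space_l1[OF b(1)])
    have "openin X W" unfolding W_def by (rule openin_l1_ball[OF b(1) x(1)])
    moreover have "x \<in> W" using x b.norm_0 by (simp add: W_def)
    moreover have "W \<subseteq> {x \<in> E. T x \<in> U}"
    proof
      fix y assume "y \<in> W"
      then have y: "y \<in> E" "l1_norm b (y - x) < 1"
        using b.norm_minus_commute[OF x(1)] by (auto simp: W_def)
      have yx: "y - x \<in> E" by (rule b.diff_mem[OF y(1) x(1)])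
      have "l1_norm a (T (y - x)) < 1" using b(2)[OF yx] y(2) by simp
      then have "T (y - x) \<in> U'"
        using poly_causal_maps[OF T less_imp_le[OF B] yx] by (intro a(2))
      then have "T (y - x) + T x \<in> U" by (simp add: U'_def)
      moreover have "T (y - x + x) = T (y - x) + T x"
        by (rule poly_causal_add[OF T yx x(1)])
      ultimately show "y \<in> {x \<in> E. T x \<in> U}" using y(1) by simp
    qed
    ultimately show "\<exists>W. openin X W \<and> x \<in> W \<and> W \<subseteq> {x \<in> E. T x \<in> U}" by blast
  qed
qed

lemma poly_causal_subset_ops: "0 < B \<Longrightarrow> poly_causal B K \<subseteq> cont_linear_ops X"
  using poly_causal_continuous by (auto simp: cont_linear_ops_def poly_causal_def)

lemma equicontinuous_poly_causal:
  assumes B: "0 < B" and H: "H \<subseteq> poly_causal B K"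
  shows "equicontinuous X H"
  unfolding equicontinuous_def
proof (intro conjI allI impI)
  show "H \<subseteq> cont_linear_ops X" using H poly_causal_subset_ops[OF B] by blast
  fix V assume "openin X V \<and> 0 \<in> V"
  then obtain a where a: "a \<in> dual_weights" "\<And>z. z \<in> E \<Longrightarrow> l1_norm a z < 1 \<Longrightarrow> z \<in> V"
    using nbhd_contains_l1_ball by metis
  obtain b where b: "b \<in> dual_weights"
    "\<And>T x. T \<in> poly_causal B K \<Longrightarrow> x \<in> E \<Longrightarrow> l1_norm a (T x) \<le> l1_norm b x"
    using poly_causal_l1_bound[OF B a(1)] by metis
  interpret b: normed_cseq_space E "l1_norm b" by (rule normed_cseq_space_l1[OF b(1)])
  have 0: "0 \<in> E" by (rule cseq.subspace_0[OF subspace_X])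
  define U where "U = {y \<in> E. l1_norm b (0 - y) < 1}"
  have "openin X U" unfolding U_def by (rule openin_l1_ball[OF b(1) 0])
  moreover have "0 \<in> U" using 0 b.norm_0 by (simp add: U_def)
  moreover have "S ` U \<subseteq> V" if S: "S \<in> H" for S
  proof
    fix z assume "z \<in> S ` U"
    then obtain y where y: "z = S y" "y \<in> E" "l1_norm b y < 1" by (auto simp: U_def b.norm_uminus)
    have Sp: "S \<in> poly_causal B K" using S H by blast
    show "z \<in> V"
      unfolding y(1) using b(2)[OF Sp y(2)] y(3) poly_causal_maps[OF Sp less_imp_le[OF B] y(2)]
      by (intro a(2)) auto
  qed
  ultimately show "\<exists>U. openin X U \<and> 0 \<in> U \<and> (\<forall>S\<in>H. S ` U \<subseteq> V)" by blast
qed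

end

section \<open>Resolvents and eigenvectors of the Cesaro operator\<close>

lemma Sigma_set_iff: "l \<in> Sigma_set \<longleftrightarrow> (\<exists>n. l = 1 / of_nat (Suc n))"
proof
  assume "l \<in> Sigma_set"
  then obtain n where "n \<ge> 1" "l = 1 / of_nat n" by (auto simp: Sigma_set_def)
  then show "\<exists>n. l = 1 / of_nat (Suc n)" by (intro exI[of _ "n - 1"]) simp
next
  assume "\<exists>n. l = 1 / of_nat (Suc n)"
  then show "l \<in> Sigma_set" unfolding Sigma_set_def using Suc_le_mono by fastforce
qed

text \<open>
  The partial sums \<open>S\<close> of the solution \<open>x\<close> of \<open>l x - C x = y\<close>. With entry number \<open>n + 1\<close> at index \<open>n\<close>, the
  equation reads \<open>l (S\<^sub>n - S\<^sub>n\<^sub>-\<^sub>1) - S\<^sub>n / (n + 1) = y\<^sub>n\<close>, which is solved for \<open>S\<^sub>n\<close>.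
\<close>

primrec res_sum :: "complex \<Rightarrow> cseq \<Rightarrow> nat \<Rightarrow> complex" where
  "res_sum l y 0 = y 0 / (l - 1)"
| "res_sum l y (Suc n) = (y (Suc n) + l * res_sum l y n) / (l - 1 / of_nat (Suc (Suc n)))"

definition Cesaro_res :: "complex \<Rightarrow> cseq \<Rightarrow> cseq" where
  "Cesaro_res l y n = (case n of 0 \<Rightarrow> res_sum l y 0 | Suc m \<Rightarrow> res_sum l y (Suc m) - res_sum l y m)"

lemma sum_Cesaro_res: "(\<Sum>i\<le>n. Cesaro_res l y i) = res_sum l y n"
  by (induction n) (simp_all add: Cesaro_res_def)

lemma shift_op_Cesaro: "shift_op Cesaro l x n = l * x n - (\<Sum>i\<le>n. x i) / of_nat (Suc n)"
  by (simp add: shift_op_def cscale_def Cesaro_def)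

lemma Cesaro_res_right_inverse:
  assumes l: "l \<notin> Sigma_set"
  shows "shift_op Cesaro l (Cesaro_res l y) = y"
proof
  fix n
  have ne: "l - 1 / of_nat (Suc n) \<noteq> 0" for n using l by (auto simp: Sigma_set_iff)
  show "shift_op Cesaro l (Cesaro_res l y) n = y n"
  proof (cases n)
    case 0
    have "shift_op Cesaro l (Cesaro_res l y) n = (l - 1) * (y 0 / (l - 1))"
      unfolding shift_op_Cesaro sum_Cesaro_res by (simp add: 0 Cesaro_res_def left_diff_distrib diff_divide_distrib)
    also have "\<dots> = y n" using ne[of 0] by (simp add: 0)
    finally show ?thesis .
  next
    case (Suc m)
    let ?d = "l - 1 / of_nat (Suc (Suc m))"
    have "shift_op Cesaro l (Cesaro_res l y) n = ?d * res_sum l y (Suc m) - l * res_sum l y m"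
      unfolding shift_op_Cesaro sum_Cesaro_res
      by (simp add: Suc Cesaro_res_def left_diff_distrib right_diff_distrib del: of_nat_Suc res_sum.simps)
    also have "?d * res_sum l y (Suc m) = y (Suc m) + l * res_sum l y m"
      unfolding res_sum.simps(2) using ne[of "Suc m"] by (simp del: of_nat_Suc)
    finally show ?thesis by (simp add: Suc)
  qed
qed

lemma Cesaro_res_left_inverse:
  assumes l: "l \<notin> Sigma_set"
  shows "Cesaro_res l (shift_op Cesaro l x) = x"
proof -
  have ne: "l - 1 / of_nat (Suc n) \<noteq> 0" for n using l by (auto simp: Sigma_set_iff)
  have sum: "res_sum l (shift_op Cesaro l x) n = (\<Sum>i\<le>n. x i)" for n
  proof (induction n)
    case 0
    have "shift_op Cesaro l x 0 = (l - 1) * x 0" by (simp add: shift_op_Cesaro left_diff_distrib)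
    then show ?case using ne[of 0] by simp
  next
    case (Suc n)
    have "shift_op Cesaro l x (Suc n) + l * (\<Sum>i\<le>n. x i)
        = (l - 1 / of_nat (Suc (Suc n))) * (\<Sum>i\<le>Suc n. x i)"
      unfolding shift_op_Cesaro by (simp add: left_diff_distrib distrib_left add_divide_distrib del: of_nat_Suc)
    then show ?case
      unfolding res_sum.simps(2) Suc using ne[of "Suc n"] by (simp del: of_nat_Suc sum.atMost_Suc)
  qed
  show ?thesis
  proof
    fix n show "Cesaro_res l (shift_op Cesaro l x) n = x n"
      by (cases n) (simp_all only: Cesaro_res_def nat.case sum, simp_all)
  qed
qed

lemma Cesaro_res_add: "Cesaro_res l (x + y) = Cesaro_res l x + Cesaro_res l y"
proof -
  have "res_sum l (x + y) n = res_sum l x n + res_sum l y n" for n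
    by (induction n) (simp_all add: add_divide_distrib distrib_left)
  then show ?thesis by (simp add: fun_eq_iff Cesaro_res_def split: nat.split del: res_sum.simps)
qed

lemma Cesaro_res_scale: "Cesaro_res l (c *\<^sub>C x) = c *\<^sub>C Cesaro_res l x"
proof -
  have "res_sum l (c *\<^sub>C x) n = c * res_sum l x n" for n
    by (induction n) (simp_all add: cscale_def distrib_left mult_ac)
  then show ?thesis
    by (simp add: fun_eq_iff Cesaro_res_def cscale_def right_diff_distrib split: nat.split del: res_sum.simps)
qed

lemma Cesaro_res_bound:
  assumes sum_bound: "\<And>n. cmod (res_sum l y n) \<le> A * real (Suc n) ^ K * (\<Sum>i\<le>n. cmod (y i))" and A: "0 \<le> A"
  shows "cmod (Cesaro_res l y n) \<le> 2 * A * real (Suc n) ^ K * (\<Sum>i\<le>n. cmod (y i))"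
proof (cases n)
  case 0
  have "0 \<le> A * real (Suc 0) ^ K * (\<Sum>i\<le>0. cmod (y i))" using A by simp
  then show ?thesis using sum_bound[of 0] by (simp add: 0 Cesaro_res_def del: res_sum.simps)
next
  case (Suc m)
  let ?R = "A * real (Suc n) ^ K * (\<Sum>i\<le>n. cmod (y i))"
  have "cmod (res_sum l y m) \<le> A * real (Suc m) ^ K * (\<Sum>i\<le>m. cmod (y i))" by (rule sum_bound)
  also have "\<dots> \<le> ?R"
    using A Suc by (intro mult_mono power_mono sum_mono2 mult_left_mono) (auto intro: sum_nonneg)
  finally have "cmod (res_sum l y m) \<le> ?R" .
  then have "cmod (res_sum l y n - res_sum l y m) \<le> ?R + ?R"
    by (intro norm_triangle_le_diff add_mono sum_bound)
  then show ?thesis by (simp add: Suc Cesaro_res_def mult_ac)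
qed

text \<open>
  The recursion multiplies \<open>S\<^sub>n\<^sub>-\<^sub>1\<close> by \<open>l / (l - 1/(n + 1)) = 1 + 1/((n + 1) (l - 1/(n + 1)))\<close>, of modulus at
  most \<open>1 + K/(n + 1)\<close>. By the Bernoulli inequality this is at most \<open>(1 + 1/(n + 1))\<^sup>K\<close>, and
  \<open>(1 + 1/(n + 1)) n \<le> n + 1\<close>; so the factor \<open>n\<^sup>K\<close> grows to at most \<open>(n + 1)\<^sup>K\<close>. The bound involves \<open>l\<close> only
  through its distance from the numbers \<open>1/n\<close>.
\<close>

lemma res_sum_bound:
  assumes d: "0 < d" "\<And>n. d \<le> cmod (l - 1 / of_nat (Suc n))" and K: "1 / d \<le> real K"
  shows "cmod (res_sum l y n) \<le> 1 / d * real (Suc n) ^ K * (\<Sum>i\<le>n. cmod (y i))"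
proof (induction n)
  case 0
  show ?case
    using d(1) d(2)[of 0] by (simp add: norm_divide frac_le)
next
  case (Suc n)
  let ?m = "real (Suc (Suc n))" and ?e = "l - 1 / of_nat (Suc (Suc n))" and ?Y = "\<Sum>i\<le>n. cmod (y i)"
  have e: "d \<le> cmod ?e" by (rule d(2))
  then have ce: "0 < cmod ?e" using d(1) by linarith
  then have e0: "?e \<noteq> 0" unfolding zero_less_norm_iff .
  have ratio: "cmod (l / ?e) \<le> 1 + real K / ?m"
  proof -
    have "l / ?e = 1 + 1 / of_nat (Suc (Suc n)) / ?e" using e0 by (simp add: field_simps del: of_nat_Suc)
    then have "cmod (l / ?e) \<le> 1 + cmod (1 / of_nat (Suc (Suc n)) / ?e)"
      using norm_triangle_ineq[of 1 "1 / of_nat (Suc (Suc n)) / ?e"] by simp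
    also have "cmod (1 / of_nat (Suc (Suc n)) / ?e) = 1 / ?m / cmod ?e"
      unfolding norm_divide norm_one norm_of_nat ..
    also have "\<dots> \<le> 1 / ?m / d" by (intro divide_left_mono mult_pos_pos e ce d(1)) simp_all
    also have "\<dots> = 1 / d / ?m" by simp
    also have "\<dots> \<le> real K / ?m" using K by (intro divide_right_mono) auto
    finally show ?thesis by simp
  qed
  have pow: "(1 + real K / ?m) * real (Suc n) ^ K \<le> ?m ^ K"
  proof -
    have "- 1 \<le> 1 / ?m" by (rule order_trans[of _ 0]) simp_all
    then have "1 + real K / ?m \<le> (1 + 1 / ?m) ^ K"
      using Bernoulli_inequality[of "1 / ?m" K] by simp
    then have "(1 + real K / ?m) * real (Suc n) ^ K \<le> (1 + 1 / ?m) ^ K * real (Suc n) ^ K"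
      by (intro mult_right_mono) auto
    also have "\<dots> = ((1 + 1 / ?m) * real (Suc n)) ^ K" by (rule power_mult_distrib[symmetric])
    also have "\<dots> \<le> ?m ^ K" by (intro power_mono) (auto simp: field_simps)
    finally show ?thesis .
  qed
  have "res_sum l y (Suc n) = y (Suc n) / ?e + l / ?e * res_sum l y n"
    unfolding res_sum.simps(2) by (simp add: add_divide_distrib)
  then have "cmod (res_sum l y (Suc n)) \<le> cmod (y (Suc n) / ?e) + cmod (l / ?e) * cmod (res_sum l y n)"
    by (metis norm_mult norm_triangle_ineq)
  also have "\<dots> \<le> 1 / d * ?m ^ K * cmod (y (Suc n)) + 1 / d * ?m ^ K * ?Y"
  proof (rule add_mono)
    have "cmod (y (Suc n) / ?e) \<le> cmod (y (Suc n)) / d"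
      unfolding norm_divide by (intro divide_left_mono mult_pos_pos e ce d(1)) simp_all
    also have "\<dots> \<le> 1 / d * ?m ^ K * cmod (y (Suc n))"
      using d(1) mult_right_mono[OF one_le_power[of ?m K], of "cmod (y (Suc n)) / d"]
      by (simp add: mult_ac)
    finally show "cmod (y (Suc n) / ?e) \<le> 1 / d * ?m ^ K * cmod (y (Suc n))" .
    have "cmod (l / ?e) * cmod (res_sum l y n) \<le> (1 + real K / ?m) * (1 / d * real (Suc n) ^ K * ?Y)"
      by (intro mult_mono ratio Suc.IH) auto
    also have "\<dots> = (1 + real K / ?m) * real (Suc n) ^ K * (1 / d * ?Y)" by (simp only: mult_ac)
    also have "\<dots> \<le> ?m ^ K * (1 / d * ?Y)"
      using d(1) by (intro mult_right_mono pow) (simp add: sum_nonneg)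
    also have "\<dots> = 1 / d * ?m ^ K * ?Y" by (simp only: mult_ac)
    finally show "cmod (l / ?e) * cmod (res_sum l y n) \<le> 1 / d * ?m ^ K * ?Y" .
  qed
  also have "\<dots> = 1 / d * ?m ^ K * (\<Sum>i\<le>Suc n. cmod (y i))"
    by (simp only: sum.atMost_Suc distrib_left add.commute)
  finally show ?case .
qed

text \<open>
  For \<open>l = 0\<close> the distance from the numbers \<open>1/n\<close> is zero, but the recursion degenerates to
  \<open>S\<^sub>n = - (n + 1) y\<^sub>n\<close>. The constants 1 are kept to match the shape of the general bound.
\<close>

lemma res_sum_zero_bound: "cmod (res_sum 0 y n) \<le> 1 * real (Suc n) ^ 1 * (\<Sum>i\<le>n. cmod (y i))"
proof -
  have "cmod (res_sum 0 y n) = real (Suc n) * cmod (y n)"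
    by (cases n) (simp_all add: norm_mult norm_minus_commute del: of_nat_Suc)
  moreover have "cmod (y n) \<le> (\<Sum>i\<le>n. cmod (y i))" by (rule member_le_sum) auto
  ultimately show ?thesis by (simp add: mult_left_mono)
qed

lemma sum_binomial_column: "(\<Sum>i\<le>n. i choose m) = Suc n choose Suc m"
  using sum_choose_upper[of m n] by (simp add: atMost_atLeast0)

definition Cesaro_eigenvector :: "nat \<Rightarrow> cseq" where
  "Cesaro_eigenvector m = (\<lambda>n. of_nat (n choose m))"

text \<open>
  The hockey-stick identity sums the column \<open>m\<close> of the Pascal triangle, and
  \<open>(m + 1) (n + 1 choose m + 1) = (n + 1) (n choose m)\<close> turns the mean back into the last entry.
\<close>

lemma shift_op_eigenvector: "shift_op Cesaro (1 / of_nat (Suc m)) (Cesaro_eigenvector m) = 0"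
proof
  fix n
  have "Suc m * (Suc n choose Suc m) = Suc n * (n choose m)"
    by (rule Suc_times_binomial)
  then have "(of_nat (Suc m) * of_nat (Suc n choose Suc m) :: complex) = of_nat (Suc n) * of_nat (n choose m)"
    unfolding of_nat_mult[symmetric] by (rule arg_cong)
  moreover have "(\<Sum>i\<le>n. Cesaro_eigenvector m i) = of_nat (Suc n choose Suc m)"
    unfolding Cesaro_eigenvector_def of_nat_sum[symmetric] sum_binomial_column ..
  ultimately show "shift_op Cesaro (1 / of_nat (Suc m)) (Cesaro_eigenvector m) n = 0 n"
    unfolding shift_op_Cesaro by (simp add: Cesaro_eigenvector_def field_simps del: of_nat_Suc binomial_Suc_Suc)
qed

text \<open>
  \<open>\<Sigma>\<^sub>0\<close> is a convergent sequence with its limit, hence closed. Halving the radius of a disc that avoids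
  it gives one \<open>d\<close> that bounds the distance from the numbers \<open>1/n\<close> for the whole disc.
\<close>

lemma eigenvalues_away:
  assumes l: "l \<notin> Sigma0_set"
  obtains d where "0 < d" "\<And>\<mu> n. \<mu> \<in> ball l d \<Longrightarrow> d \<le> cmod (\<mu> - 1 / of_nat (Suc n))"
    "ball l d \<inter> Sigma_set = {}"
proof -
  have "(\<lambda>n. 1 / of_nat (Suc n)) \<longlonglongrightarrow> (0 :: complex)"
    using LIMSEQ_Suc[OF lim_1_over_n] by simp
  then have "compact (insert 0 (range (\<lambda>n. 1 / of_nat (Suc n) :: complex)))"
    by (rule compact_sequence_with_limit)
  moreover have "insert 0 (range (\<lambda>n. 1 / of_nat (Suc n) :: complex)) = Sigma0_set"
    by (auto simp: Sigma0_set_def Sigma_set_iff)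
  ultimately have "open (- Sigma0_set)" by (metis compact_imp_closed open_Compl)
  then obtain e where e: "e > 0" "ball l e \<subseteq> - Sigma0_set" using l unfolding open_contains_ball by blast
  have away: "e \<le> cmod (l - 1 / of_nat (Suc n))" for n
  proof (rule ccontr)
    assume "\<not> e \<le> cmod (l - 1 / of_nat (Suc n))"
    then have "1 / of_nat (Suc n) \<in> ball l e" by (simp add: dist_norm)
    moreover have "1 / of_nat (Suc n) \<in> Sigma0_set" by (auto simp: Sigma0_set_def Sigma_set_iff)
    ultimately show False using e(2) by blast
  qed
  show thesis
  proof (rule that)
    show "0 < e / 2" using e(1) by simp
    show le: "e / 2 \<le> cmod (\<mu> - 1 / of_nat (Suc n))" if "\<mu> \<in> ball l (e / 2)" for \<mu> n
      using that away[of n] norm_triangle_ineq[of "l - \<mu>" "\<mu> - 1 / of_nat (Suc n)"]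
      by (simp add: dist_norm)
    show "ball l (e / 2) \<inter> Sigma_set = {}"
    proof (rule equals0I)
      fix \<mu> assume "\<mu> \<in> ball l (e / 2) \<inter> Sigma_set"
      then obtain n where "\<mu> \<in> ball l (e / 2)" "\<mu> = 1 / of_nat (Suc n)"
        unfolding Sigma_set_iff Int_iff by blast
      then show False using le[of \<mu> n] e(1) by (simp del: of_nat_Suc)
    qed
  qed
qed

section \<open>The spectra\<close>

context nuclear_coechelon
begin

lemma Cesaro_poly_causal: "Cesaro \<in> poly_causal 1 0"
  unfolding poly_causal_def
proof (intro CollectI conjI ballI allI)
  show "Cesaro (x + y) = Cesaro x + Cesaro y" for x y
    by (simp add: Cesaro_def fun_eq_iff sum.distrib add_divide_distrib)
  show "Cesaro (c *\<^sub>C x) = c *\<^sub>C Cesaro x" for c x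
    by (simp add: Cesaro_def fun_eq_iff cscale_def sum_distrib_left)
  fix x :: cseq and n
  have "cmod (Cesaro x n) = cmod (\<Sum>i\<le>n. x i) / real (Suc n)"
    unfolding Cesaro_def norm_divide norm_of_nat ..
  also have "\<dots> \<le> cmod (\<Sum>i\<le>n. x i) / 1" by (intro divide_left_mono) auto
  also have "\<dots> \<le> (\<Sum>i\<le>n. cmod (x i))" by (simp add: norm_sum)
  finally show "cmod (Cesaro x n) \<le> 1 * real (Suc n) ^ 0 * (\<Sum>i\<le>n. cmod (x i))" by simp
qed

text \<open>
  On all sequences \<open>Cesaro_res l\<close> is a two-sided inverse of \<open>l - C\<close>. A polynomial bound on the partial
  sums makes it preserve \<open>E\<close>, where it therefore agrees with the resolvent.
\<close>

lemma resolvent_poly_causal: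
  assumes l: "l \<notin> Sigma_set" and A: "0 \<le> A"
    and sum_bound: "\<And>y n. cmod (res_sum l y n) \<le> A * real (Suc n) ^ K * (\<Sum>i\<le>n. cmod (y i))"
  shows "bij_betw (shift_op Cesaro l) E E" and "resolvent X Cesaro l \<in> poly_causal (2 * A) K"
proof -
  have R: "Cesaro_res l \<in> poly_causal (2 * A) K"
    unfolding poly_causal_def
    using Cesaro_res_add Cesaro_res_scale Cesaro_res_bound[OF sum_bound A] by blast
  have shift: "shift_op Cesaro l x \<in> E" if "x \<in> E" for x
    unfolding shift_op_def using poly_causal_maps[OF Cesaro_poly_causal] that
    by (intro cseq.subspace_diff cseq.subspace_scale subspace_X) auto
  have res: "Cesaro_res l x \<in> E" if "x \<in> E" for x
    using poly_causal_maps[OF R _ that] A by simp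
  show bij: "bij_betw (shift_op Cesaro l) E E"
    by (rule bij_betw_byWitness[where f' = "Cesaro_res l"])
       (use shift res Cesaro_res_left_inverse[OF l] Cesaro_res_right_inverse[OF l] in auto)
  have eq: "resolvent X Cesaro l x = Cesaro_res l x" if "x \<in> E" for x
    unfolding resolvent_def
    by (rule inv_into_f_eq) (use bij res[OF that] Cesaro_res_right_inverse[OF l] in \<open>auto simp: bij_betw_def\<close>)
  show "resolvent X Cesaro l \<in> poly_causal (2 * A) K"
    using R eq by (simp add: poly_causal_def cseq.subspace_add[OF subspace_X] cseq.subspace_scale[OF subspace_X])
qed

text \<open>
  The eigenvector \<open>n choose m\<close> is at most \<open>(n + 1)\<^sup>m\<close>, and \<open>E\<close> contains all sequences of polynomial
  growth.
\<close>

lemma Sigma_subset_point_spectrum: "Sigma_set \<subseteq> point_spectrum X Cesaro"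
proof
  fix l assume "l \<in> Sigma_set"
  then obtain m where m: "l = 1 / of_nat (Suc m)" by (auto simp: Sigma_set_iff)
  let ?x = "Cesaro_eigenvector m"
  obtain k where k: "\<And>n. real (Suc n) ^ m * growth 0 n \<le> growth k n" using power_absorbed by blast
  have "?x \<in> E"
  proof (rule mem_X_if_bound)
    fix n
    have "n choose m \<le> Suc n ^ m" using binomial_le_pow[of m n] power_mono[of n "Suc n" m]
      by (cases "m \<le> n") (auto simp: binomial_eq_0)
    then have "cmod (?x n) \<le> real (Suc n) ^ m"
      by (simp add: Cesaro_eigenvector_def flip: of_nat_power del: of_nat_Suc)
    also have "\<dots> \<le> real (Suc n) ^ m * growth 0 n" using growth_ge_1[of 0 n] by simp
    also have "\<dots> \<le> growth k n" by (rule k)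
    finally show "cmod (?x n) \<le> 1 * growth k n" by simp
  qed
  moreover have "shift_op Cesaro l ?x = shift_op Cesaro l 0"
    unfolding m shift_op_eigenvector by (simp add: fun_eq_iff shift_op_Cesaro)
  moreover have "?x \<noteq> 0"
    by (auto simp: fun_eq_iff Cesaro_eigenvector_def intro!: exI[of _ m])
  ultimately have "\<not> inj_on (shift_op Cesaro l) E"
    using cseq.subspace_0[OF subspace_X] by (auto dest: inj_onD)
  then show "l \<in> point_spectrum X Cesaro" by (simp add: point_spectrum_def)
qed

lemma resolvent_set_star_Cesaro:
  assumes l: "l \<notin> Sigma0_set"
  shows "l \<in> resolvent_set_star X Cesaro"
proof -
  obtain d where d: "0 < d" "\<And>\<mu> n. \<mu> \<in> ball l d \<Longrightarrow> d \<le> cmod (\<mu> - 1 / of_nat (Suc n))"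
    "ball l d \<inter> Sigma_set = {}" by (rule eigenvalues_away[OF l]) blast
  obtain K where K: "1 / d \<le> real K" using real_arch_simple by blast
  have R: "bij_betw (shift_op Cesaro \<mu>) E E" "resolvent X Cesaro \<mu> \<in> poly_causal (2 * (1 / d)) K"
    if \<mu>: "\<mu> \<in> ball l d" for \<mu>
  proof -
    have "\<mu> \<notin> Sigma_set" "0 \<le> 1 / d" using \<mu> d(1,3) by auto
    from resolvent_poly_causal[OF this res_sum_bound[OF d(1) d(2)[OF \<mu>] K]]
    show "bij_betw (shift_op Cesaro \<mu>) E E" "resolvent X Cesaro \<mu> \<in> poly_causal (2 * (1 / d)) K"
      by blast+
  qed
  have B: "0 < 2 * (1 / d)" using d(1) by simp
  have "ball l d \<subseteq> resolvent_set X Cesaro"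
    unfolding resolvent_set_def using R poly_causal_subset_ops[OF B] by blast
  moreover have "equicontinuous X (resolvent X Cesaro ` ball l d)"
    using R by (intro equicontinuous_poly_causal[OF B]) blast
  ultimately show ?thesis unfolding resolvent_set_star_def using d(1) by blast
qed

lemma zero_in_resolvent_set: "0 \<in> resolvent_set X Cesaro"
proof -
  have 0: "0 \<notin> Sigma_set" by (auto simp: Sigma_set_iff simp del: of_nat_Suc)
  show ?thesis
    unfolding resolvent_set_def
    using resolvent_poly_causal[OF 0 zero_le_one res_sum_zero_bound] poly_causal_subset_ops[of "2 * 1" 1] by auto
qed

lemma resolvent_set_star_subset: "resolvent_set_star X T \<subseteq> resolvent_set X T"
  unfolding resolvent_set_star_def by fastforce

text \<open>
  Neither \<open>0\<close> nor a nonzero number outside \<open>\<Sigma>\<close> is in the spectrum, but no disc around \<open>0\<close> lies in the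
  resolvent set, since it contains some \<open>1/n\<close>.
\<close>

lemma spectrum_Cesaro: "spectrum X Cesaro = Sigma_set"
  and point_spectrum_Cesaro: "point_spectrum X Cesaro = Sigma_set"
  and spectrum_star_Cesaro: "spectrum_star X Cesaro = Sigma0_set"
proof -
  have pt: "point_spectrum X Cesaro \<subseteq> spectrum X Cesaro"
    by (auto simp: point_spectrum_def spectrum_def resolvent_set_def bij_betw_def)
  have "l \<in> resolvent_set X Cesaro" if "l \<notin> Sigma_set" for l
  proof (cases "l = 0")
    case False
    with that have "l \<notin> Sigma0_set" by (simp add: Sigma0_set_def)
    then show ?thesis using resolvent_set_star_Cesaro resolvent_set_star_subset by blast
  qed (simp add: zero_in_resolvent_set)
  then have "spectrum X Cesaro \<subseteq> Sigma_set" unfolding spectrum_def by blast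
  then show sp: "spectrum X Cesaro = Sigma_set" and "point_spectrum X Cesaro = Sigma_set"
    using pt Sigma_subset_point_spectrum by auto
  have "0 \<notin> resolvent_set_star X Cesaro"
  proof
    assume "0 \<in> resolvent_set_star X Cesaro"
    then obtain \<delta> where \<delta>: "\<delta> > 0" "ball 0 \<delta> \<subseteq> resolvent_set X Cesaro"
      unfolding resolvent_set_star_def by blast
    obtain n where n: "1 / real (Suc n) < \<delta>" using \<delta>(1) by (metis nat_approx_posE)
    let ?z = "1 / of_nat (Suc n) :: complex"
    have "?z \<in> ball 0 \<delta>" using n by (simp add: norm_divide del: of_nat_Suc)
    then have "?z \<in> resolvent_set X Cesaro" using \<delta>(2) by blast
    moreover have "?z \<in> Sigma_set" by (auto simp: Sigma_set_iff)
    ultimately show False using sp by (auto simp: spectrum_def)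
  qed
  moreover have "l \<notin> resolvent_set_star X Cesaro" if "l \<in> Sigma_set" for l
    using that resolvent_set_star_subset sp unfolding spectrum_def by blast
  ultimately have "l \<notin> resolvent_set_star X Cesaro" if "l \<in> Sigma0_set" for l
    using that by (auto simp: Sigma0_set_def)
  then show "spectrum_star X Cesaro = Sigma0_set"
    using resolvent_set_star_Cesaro unfolding spectrum_star_def by blast
qed

end

theorem proposition2p9:
  fixes \<alpha> s :: "nat \<Rightarrow> real"
  assumes alpha_pos: "\<And>n. 0 < \<alpha> n"
    and alpha_mono: "strict_mono \<alpha>"
    and alpha_lim: "filterlim \<alpha> at_top sequentially"
    and s_gt_1: "\<And>k. 1 < s k"
    and s_mono: "strict_mono s"
    and s_lim: "filterlim s at_top sequentially"
    and nuclear: "nuclear_space (E_space \<alpha> s)"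
  shows "Cesaro \<in> cont_linear_ops (E_space \<alpha> s) \<and>
    (spectrum (E_space \<alpha> s) Cesaro = point_spectrum (E_space \<alpha> s) Cesaro \<and>
     point_spectrum (E_space \<alpha> s) Cesaro = Sigma_set) \<and>
    (spectrum_star (E_space \<alpha> s) Cesaro = spectrum (E_space \<alpha> s) Cesaro \<union> {0} \<and>
     spectrum (E_space \<alpha> s) Cesaro \<union> {0} = Sigma0_set)"
proof -
  interpret nuclear_coechelon \<alpha> s
    by unfold_locales (fact alpha_pos alpha_mono s_gt_1 s_mono s_lim nuclear)+
  have "Cesaro \<in> cont_linear_ops X"
    using Cesaro_poly_causal poly_causal_subset_ops[of 1 0] by auto
  then show ?thesis
    by (simp add: spectrum_Cesaro point_spectrum_Cesaro spectrum_star_Cesaro Sigma0_set_def)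
qed

end
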